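(* Let $p>2$, $\alpha,\beta\in(1,\infty)$ with $\frac1\alpha+\frac1\beta=1$, assume $\sigma$ satisfies $(I_{p(\alpha\vee\beta)})$, let $\theta\in(0,\frac1{2\beta})$ and $r>0$ with $r<(\frac1{2\beta}-\theta)\wedge(\theta p-1)$. Let $(M_N)_{N\in\mathbb N}$ be positive integers with $M_N\le KN^r$ for a constant $K>0$. Then almost surely $$\lim_{N\to\infty}\sup_{t\in[-\pi,\pi]}\big|T_{M_N}[v](t)-T^B_{N,M_N}[v](t)\big|=0.$$
   Context: $(\Omega,\mathcal F,(\mathcal F_t)_{t\in[-\pi,\pi]},P)$ is a filtered probability space satisfying the usual conditions and carrying a standard Brownian motion $W$. $\sigma=(\sigma_t)_{t\in[-\pi,\pi]}$ is a real-valued progressively measurable process with continuous paths, $x\in\mathbb R$, and $H_t=x+\int_{-\pi}^t\sigma_s\,dW_s$. The volatility is $v_t:=\sigma_t^2$. For $a>0$, $\sigma$ satisfies $(I_a)$ if $E[\int_{-\pi}^{\pi}|\sigma_z|^a\,dz]<\infty$. Write $i$ for the imaginary unit. $\mathcal F[\phi](q):=\frac1{2\pi}\int_{-\pi}^{\pi}e^{-iqt}\phi(t)\,dt$. $\Gamma_z(q):=\frac1{2\pi}\int_{-\pi}^z e^{-iqt}\,dH_t$, $\mathcal F[dH](q):=\Gamma_\pi(q)$, and $\mathcal F^B_N[v](q):=\frac{2\pi}{2N+1}\sum_{|l|\le N}\mathcal F[dH](l)\,\mathcal F[dH](q-l)$. The Fejér-type trigonometric polynomials are $T_M[v](t):=\sum_{|l|\le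 M}(1-\frac{|l|}{M})\mathcal F[v](l)e^{ilt}$ and (Fourier estimator) $T^B_{N,M}[v](t):=\sum_{|l|\le M}(1-\frac{|l|}{M})\mathcal F^B_N[v](l)e^{ilt}$. *)

theory Defs
  imports "HOL-Probability.Probability"
begin

definition usual_filtered_space :: "'a measure \<Rightarrow> (real \<Rightarrow> 'a measure) \<Rightarrow> bool" where
  "usual_filtered_space M F \<longleftrightarrow>
     prob_space M \<and> filtration (space M) F \<and> (\<forall>t. sets (F t) \<subseteq> sets M) \<and>
     (\<forall>N \<in> null_sets M. \<forall>B \<subseteq> N. B \<in> sets (F (-pi))) \<and>
     (\<forall>t \<in> {-pi..<pi}. (\<Inter>s\<in>{t<..pi}. sets (F s)) = sets (F t))"

definition brownian_motion :: "'a measure \<Rightarrow> (real \<Rightarrow> 'a measure) \<Rightarrow> (real \<Rightarrow> 'a \<Rightarrow> real) \<Rightarrow> bool" where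
  "brownian_motion M F W \<longleftrightarrow>
     (\<forall>t\<in>{-pi..pi}. W t \<in> borel_measurable (F t)) \<and>
     (\<forall>\<omega>\<in>space M. continuous_on {-pi..pi} (\<lambda>t. W t \<omega>)) \<and>
     (\<forall>\<omega>\<in>space M. W (-pi) \<omega> = 0) \<and>
     (\<forall>s t. -pi \<le> s \<longrightarrow> s < t \<longrightarrow> t \<le> pi \<longrightarrow>
        distributed M lborel (\<lambda>\<omega>. W t \<omega> - W s \<omega>)
          (\<lambda>y. ennreal (normal_density 0 (sqrt (t - s)) y)) \<and>
        prob_space.indep_set M (sets (F s))
          {(\<lambda>\<omega>. W t \<omega> - W s \<omega>) -` A \<inter> space M | A. A \<in> sets borel})"

definition progressive :: "(real \<Rightarrow> 'a measure) \<Rightarrow> (real \<Rightarrow> 'a \<Rightarrow> real) \<Rightarrow> bool" where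
  "progressive F X \<longleftrightarrow>
     (\<forall>t\<in>{-pi..pi}. (\<lambda>(s, \<omega>). X s \<omega>) \<in> (restrict_space borel {-pi..t} \<Otimes>\<^sub>M F t) \<rightarrow>\<^sub>M borel)"

definition riemann_sum :: "nat \<Rightarrow> (real \<Rightarrow> 'a \<Rightarrow> real) \<Rightarrow> (real \<Rightarrow> 'a \<Rightarrow> real) \<Rightarrow> real \<Rightarrow> 'a \<Rightarrow> real" where
  "riemann_sum n \<sigma> W t \<omega> =
     (\<Sum>k<n. let tk = -pi + 2 * pi * real k / real n; tk1 = -pi + 2 * pi * real (Suc k) / real n
            in \<sigma> tk \<omega> * (W (min tk1 t) \<omega> - W (min tk t) \<omega>))"

text \<open>H is (the continuous version of) x + int_{-pi}^t sigma_s dW_s: continuous paths and the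
  Riemann sums converge to H - x uniformly on [-pi,pi] in probability (ucp); for continuous
  adapted integrands this characterises the Ito integral.\<close>
definition ito_process :: "'a measure \<Rightarrow> (real \<Rightarrow> 'a \<Rightarrow> real) \<Rightarrow> (real \<Rightarrow> 'a \<Rightarrow> real) \<Rightarrow> real
    \<Rightarrow> (real \<Rightarrow> 'a \<Rightarrow> real) \<Rightarrow> bool" where
  "ito_process M \<sigma> W x H \<longleftrightarrow>
     (\<forall>\<omega>\<in>space M. continuous_on {-pi..pi} (\<lambda>t. H t \<omega>)) \<and>
     (\<forall>n. (\<lambda>\<omega>. SUP t\<in>{-pi..pi}. \<bar>riemann_sum n \<sigma> W t \<omega> - (H t \<omega> - x)\<bar>) \<in> borel_measurable M) \<and>
     (\<forall>\<epsilon>>0. (\<lambda>n. measure M {\<omega>\<in>space M.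
         (SUP t\<in>{-pi..pi}. \<bar>riemann_sum n \<sigma> W t \<omega> - (H t \<omega> - x)\<bar>) > \<epsilon>}) \<longlonglongrightarrow> 0)"

definition cond_I :: "'a measure \<Rightarrow> real \<Rightarrow> (real \<Rightarrow> 'a \<Rightarrow> real) \<Rightarrow> bool" where
  "cond_I M a \<sigma> \<longleftrightarrow>
     (\<integral>\<^sup>+\<omega>. set_nn_integral lborel {-pi..pi} (\<lambda>z. ennreal (\<bar>\<sigma> z \<omega>\<bar> powr a)) \<partial>M) < \<infinity>"

definition fourier_v :: "(real \<Rightarrow> 'a \<Rightarrow> real) \<Rightarrow> int \<Rightarrow> 'a \<Rightarrow> complex" where
  "fourier_v \<sigma> q \<omega> =
     complex_of_real (1 / (2 * pi)) *
       integral {-pi..pi} (\<lambda>t. cis (- real_of_int q * t) * complex_of_real ((\<sigma> t \<omega>)\<^sup>2))"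

text \<open>F[dH](q) = (1/2pi) int e^{-iqt} dH_t; the integrand is deterministic and smooth, so the
  stochastic integral is given pathwise by integration by parts.\<close>
definition fourier_dH :: "(real \<Rightarrow> 'a \<Rightarrow> real) \<Rightarrow> int \<Rightarrow> 'a \<Rightarrow> complex" where
  "fourier_dH H q \<omega> =
     complex_of_real (1 / (2 * pi)) *
       (cis (- real_of_int q * pi) * complex_of_real (H pi \<omega>)
        - cis (real_of_int q * pi) * complex_of_real (H (-pi) \<omega>)
        + \<i> * of_int q * integral {-pi..pi} (\<lambda>t. cis (- real_of_int q * t) * complex_of_real (H t \<omega>)))"

definition fourier_B :: "nat \<Rightarrow> (real \<Rightarrow> 'a \<Rightarrow> real) \<Rightarrow> int \<Rightarrow> 'a \<Rightarrow> complex" where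
  "fourier_B N H q \<omega> =
     complex_of_real (2 * pi / (2 * real N + 1)) *
       (\<Sum>l\<in>{- int N..int N}. fourier_dH H l \<omega> * fourier_dH H (q - l) \<omega>)"

definition fejer_T :: "nat \<Rightarrow> (real \<Rightarrow> 'a \<Rightarrow> real) \<Rightarrow> real \<Rightarrow> 'a \<Rightarrow> complex" where
  "fejer_T m \<sigma> t \<omega> =
     (\<Sum>l\<in>{- int m..int m}. complex_of_real (1 - \<bar>real_of_int l\<bar> / real m) *
        fourier_v \<sigma> l \<omega> * cis (real_of_int l * t))"

definition fejer_TB :: "nat \<Rightarrow> nat \<Rightarrow> (real \<Rightarrow> 'a \<Rightarrow> real) \<Rightarrow> real \<Rightarrow> 'a \<Rightarrow> complex" where
  "fejer_TB N m H t \<omega> =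
     (\<Sum>l\<in>{- int m..int m}. complex_of_real (1 - \<bar>real_of_int l\<bar> / real m) *
        fourier_B N H l \<omega> * cis (real_of_int l * t))"

end

theory Submission
  imports Defs "HOL-Real_Asymp.Real_Asymp"
begin

text \<open>Almost sure statements localise: on the event \<open>sup \<bar>\<sigma>\<bar> \<le> m\<close> the coefficient may be clipped
  at \<open>\<plusminus> m\<close>, so all moments are available. Sampling on a grid with \<open>n\<close> steps turns the
  error \<open>F\<^sub>N\<^sup>B[v](q) - F[v](q)\<close> into a limit of off-diagonal quadratic forms
  \<open>\<Sum>\<^bsub>j<k\<^esub> c\<^sub>j\<^sub>k X\<^sub>j X\<^sub>k\<close> in \<open>X\<^sub>k = \<sigma>(t\<^sub>k) (W(t\<^sub>k\<^sub>+\<^sub>1) - W(t\<^sub>k))\<close> with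
  rescaled Dirichlet kernels as coefficients; the
  diagonal converges to \<open>F[v](q)\<close>. Discrete Parseval makes the inner sums subgaussian with variance
  of order \<open>1/N\<close>, so the quadratic form has a bounded exponential moment at scale \<open>\<surd>N\<close>, uniformly
  in \<open>n\<close> and \<open>q\<close>. Fatou along an almost surely convergent subsequence and a Borel-Cantelli argument
  over \<open>N\<close> and \<open>\<bar>q\<bar> \<le> M\<^sub>N\<close> bound every coefficient error by a multiple of \<open>ln N / \<surd>N\<close>; there are
  \<open>O(N\<^sup>r)\<close> of them and \<open>r < 1/2\<close>.\<close>

section \<open>Exponential moments of Gaussian variables\<close>

text \<open>Exponential moments are used because Borel-Cantelli runs over all \<open>N\<close> and
  all \<open>\<bar>q\<bar> \<le> M\<^sub>N\<close>: power moments would pay for this union with a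
  power of \<open>N\<close>, exponential ones pay only a logarithm. Two limits are nested. At fixed
  \<open>N\<close> the mesh goes to zero first, so every estimate has to be free of
  \<open>n\<close>; only \<open>2 * N < n\<close> is asked, so that differences of frequencies up to
  \<open>2 * N\<close> do not alias on the grid. The diagonal has to be split off because there the
  kernel equals e^{-iqt} / (2 pi) for every \<open>N\<close>: it carries the quadratic variation,
  hence F[v](q) itself, and does not become small. Off the diagonal the squared kernel sums over a
  column to order n / N. Clipping changes the coefficient but not \<open>H\<close>. The clipped sums
  satisfy their bounds on the whole space, and on a path with \<bar>\<sigma>\<bar> \<le> m they
  coincide with the Riemann sums that determine \<open>H\<close>; since paths are continuous,
  countably many levels m exhaust the space. A subsequence of grids enters because \<open>H\<close>
  is given by convergence in probability.\<close>

lemma nn_integral_normal_density: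
  assumes "0 < s"
  shows "(\<integral>\<^sup>+y. ennreal (normal_density \<mu> s y) \<partial>lborel) = 1"
  using assms by (subst nn_integral_eq_integral) auto

text \<open>Completing the square: the exponential tilt merely moves the mean to
  \<open>b * s\<^sup>2\<close>.\<close>

lemma nn_integral_exp_linear_normal:
  assumes "0 < s"
  shows "(\<integral>\<^sup>+y. ennreal (normal_density 0 s y) * ennreal (exp (b * y)) \<partial>lborel)
    = ennreal (exp (b\<^sup>2 * s\<^sup>2 / 2))"
proof -
  have "normal_density 0 s y * exp (b * y) = exp (b\<^sup>2 * s\<^sup>2 / 2) * normal_density (b * s\<^sup>2) s y" for y
  proof -
    have "- (y - 0)\<^sup>2 / (2 * s\<^sup>2) + b * y = b\<^sup>2 * s\<^sup>2 / 2 + - (y - b * s\<^sup>2)\<^sup>2 / (2 * s\<^sup>2)"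
      using assms by (simp add: field_simps power2_eq_square)
    then have "exp (- (y - 0)\<^sup>2 / (2 * s\<^sup>2)) * exp (b * y)
        = exp (b\<^sup>2 * s\<^sup>2 / 2) * exp (- (y - b * s\<^sup>2)\<^sup>2 / (2 * s\<^sup>2))"
      by (simp only: exp_add [symmetric])
    then show ?thesis
      by (simp add: normal_density_def)
  qed
  then have "(\<integral>\<^sup>+y. ennreal (normal_density 0 s y) * ennreal (exp (b * y)) \<partial>lborel)
    = (\<integral>\<^sup>+y. ennreal (exp (b\<^sup>2 * s\<^sup>2 / 2)) * ennreal (normal_density (b * s\<^sup>2) s y) \<partial>lborel)"
    by (simp add: ennreal_mult [symmetric])
  also have "\<dots> = ennreal (exp (b\<^sup>2 * s\<^sup>2 / 2))"
    using assms by (subst nn_integral_cmult) (auto simp: nn_integral_normal_density)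
  finally show ?thesis .
qed

lemma nn_integral_exp_square_normal:
  assumes "0 < s" and b: "2 * b * s\<^sup>2 < 1"
  shows "(\<integral>\<^sup>+y. ennreal (normal_density 0 s y) * ennreal (exp (b * y\<^sup>2)) \<partial>lborel)
    = ennreal (1 / sqrt (1 - 2 * b * s\<^sup>2))"
proof -
  \<comment> \<open>The tilted density is again a centred Gaussian one, with standard deviation
    \<open>s / w\<close>; the normalisation it lacks is the factor \<open>1 / w\<close>.\<close>
  define w where "w = sqrt (1 - 2 * b * s\<^sup>2)"
  have w: "w > 0" "w\<^sup>2 = 1 - 2 * b * s\<^sup>2"
    using b by (auto simp: w_def)
  have nd: "normal_density 0 s y * exp (b * y\<^sup>2) = (1 / w) * normal_density 0 (s / w) y" for y
  proof -
    have "- (y - 0)\<^sup>2 / (2 * s\<^sup>2) + b * y\<^sup>2 = - (y - 0)\<^sup>2 / (2 * (s / w)\<^sup>2)"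
      using assms w by (simp add: power_divide) (simp add: field_simps)
    then have "exp (- (y - 0)\<^sup>2 / (2 * s\<^sup>2)) * exp (b * y\<^sup>2) = exp (- (y - 0)\<^sup>2 / (2 * (s / w)\<^sup>2))"
      by (simp only: exp_add [symmetric])
    moreover have "1 / sqrt (2 * pi * s\<^sup>2) = (1 / w) * (1 / sqrt (2 * pi * (s / w)\<^sup>2))"
      using assms(1) w(1) by (simp add: real_sqrt_mult real_sqrt_divide power_divide del: times_divide_eq_right)
    ultimately show ?thesis
      unfolding normal_density_def by (simp only: mult.assoc)
  qed
  then have "(\<integral>\<^sup>+y. ennreal (normal_density 0 s y) * ennreal (exp (b * y\<^sup>2)) \<partial>lborel)
    = (\<integral>\<^sup>+y. ennreal (1 / w) * ennreal (normal_density 0 (s / w) y) \<partial>lborel)"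
    using w by (simp add: ennreal_mult [symmetric])
  also have "\<dots> = ennreal (1 / w)"
    using assms w by (subst nn_integral_cmult) (auto simp: nn_integral_normal_density)
  finally show ?thesis unfolding w_def .
qed

text \<open>Centring removes the first-order term of the log moment -ln (1 - 2 b s^2) / 2, and what
  remains is at most 4 b^2 s^4 in the stated range. Paying that compensator gives a squared
  increment a factor of conditional mean at most 1.\<close>

lemma nn_integral_exp_centred_square_normal_le:
  assumes "0 < s" and b: "\<bar>b\<bar> * s\<^sup>2 \<le> 1 / 4"
  shows "(\<integral>\<^sup>+y. ennreal (normal_density 0 s y) *
      ennreal (exp (b * (y\<^sup>2 - s\<^sup>2) - 4 * b\<^sup>2 * (s\<^sup>2)\<^sup>2)) \<partial>lborel) \<le> 1"
proof -
  \<comment> \<open>\<open>1 + u\<close> is the number under the root in the Gaussian integral; the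
    hypothesis on \<open>b\<close> puts \<open>u\<close> into the range \<bar>u\<bar> \<le> 1/2 of
    the logarithm estimate.\<close>
  define u where "u = - (2 * b * s\<^sup>2)"
  have u: "\<bar>u\<bar> \<le> 1 / 2"
    using b by (simp add: u_def abs_mult)
  then have "\<bar>ln (1 + u) - u\<bar> \<le> 2 * u\<^sup>2"
    by (rule abs_ln_one_plus_x_minus_x_bound)
  then have "u - 2 * u\<^sup>2 \<le> ln (1 + u)" by linarith
  then have "exp ((u - 2 * u\<^sup>2) / 2) \<le> exp (ln (1 + u) / 2)" by simp
  also have "\<dots> = sqrt (1 + u)"
    using u by (subst ln_sqrt [symmetric]) auto
  finally have "exp ((u - 2 * u\<^sup>2) / 2) \<le> sqrt (1 + u)" .
  moreover have "(u - 2 * u\<^sup>2) / 2 = - b * s\<^sup>2 - 4 * b\<^sup>2 * (s\<^sup>2)\<^sup>2"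
    by (simp add: u_def power2_eq_square field_simps)
  moreover have "1 + u = 1 - 2 * b * s\<^sup>2"
    by (simp add: u_def)
  ultimately have *: "exp (- b * s\<^sup>2 - 4 * b\<^sup>2 * (s\<^sup>2)\<^sup>2) \<le> sqrt (1 - 2 * b * s\<^sup>2)"
    by metis
  have pos: "1 - 2 * b * s\<^sup>2 > 0" using u by (simp add: u_def)
  have "(\<integral>\<^sup>+y. ennreal (normal_density 0 s y) *
      ennreal (exp (b * (y\<^sup>2 - s\<^sup>2) - 4 * b\<^sup>2 * (s\<^sup>2)\<^sup>2)) \<partial>lborel)
    = (\<integral>\<^sup>+y. ennreal (exp (- b * s\<^sup>2 - 4 * b\<^sup>2 * (s\<^sup>2)\<^sup>2)) *
        (ennreal (normal_density 0 s y) * ennreal (exp (b * y\<^sup>2))) \<partial>lborel)"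
  proof (intro nn_integral_cong)
    fix y :: real
    have "exp (b * (y\<^sup>2 - s\<^sup>2) - 4 * b\<^sup>2 * (s\<^sup>2)\<^sup>2)
        = exp (- b * s\<^sup>2 - 4 * b\<^sup>2 * (s\<^sup>2)\<^sup>2) * exp (b * y\<^sup>2)"
      by (simp add: exp_add [symmetric] algebra_simps)
    then show "ennreal (normal_density 0 s y) *
        ennreal (exp (b * (y\<^sup>2 - s\<^sup>2) - 4 * b\<^sup>2 * (s\<^sup>2)\<^sup>2))
      = ennreal (exp (- b * s\<^sup>2 - 4 * b\<^sup>2 * (s\<^sup>2)\<^sup>2)) *
        (ennreal (normal_density 0 s y) * ennreal (exp (b * y\<^sup>2)))"
      by (simp add: ennreal_mult mult_ac)
  qed
  also have "\<dots> = ennreal (exp (- b * s\<^sup>2 - 4 * b\<^sup>2 * (s\<^sup>2)\<^sup>2)) * ennreal (1 / sqrt (1 - 2 * b * s\<^sup>2))"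
    using assms(1) pos by (subst nn_integral_cmult) (auto simp: nn_integral_exp_square_normal)
  also have "\<dots> = ennreal (exp (- b * s\<^sup>2 - 4 * b\<^sup>2 * (s\<^sup>2)\<^sup>2) / sqrt (1 - 2 * b * s\<^sup>2))"
    using pos by (simp add: ennreal_mult [symmetric] del: mult_minus_left)
  also have "\<dots> \<le> ennreal 1"
    using * pos by (intro ennreal_leI) (simp add: divide_le_eq del: mult_minus_left)
  finally show ?thesis by simp
qed

text \<open>Writing \<open>exp (s\<^sup>2 y\<^sup>2 / 2)\<close> as the Gaussian average of \<open>exp (s g y)\<close> over \<open>g\<close> turns a
  bound on the exponential moments into one on those of the square.\<close>

lemma nn_integral_exp_square_subgaussian:
  fixes Y :: "'a \<Rightarrow> real"
  assumes "sigma_finite_measure M" and [measurable]: "Y \<in> borel_measurable M"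
    and sub: "\<And>l. (\<integral>\<^sup>+\<omega>. ennreal (exp (l * Y \<omega>)) \<partial>M) \<le> ennreal (exp (l\<^sup>2 * V / 2))"
    and V: "s\<^sup>2 * V \<le> 3 / 4"
  shows "(\<integral>\<^sup>+\<omega>. ennreal (exp (s\<^sup>2 * (Y \<omega>)\<^sup>2 / 2)) \<partial>M) \<le> 2"
proof -
  interpret sigma_finite_measure M by fact
  interpret pair_sigma_finite M lborel ..
  have "(\<integral>\<^sup>+\<omega>. ennreal (exp (s\<^sup>2 * (Y \<omega>)\<^sup>2 / 2)) \<partial>M)
    = (\<integral>\<^sup>+\<omega>. (\<integral>\<^sup>+g. ennreal (normal_density 0 1 g) * ennreal (exp ((s * Y \<omega>) * g)) \<partial>lborel) \<partial>M)"
    by (simp only: nn_integral_exp_linear_normal zero_less_one) (simp add: power_mult_distrib)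
  also have "\<dots> = (\<integral>\<^sup>+g. (\<integral>\<^sup>+\<omega>. ennreal (normal_density 0 1 g) * ennreal (exp ((s * Y \<omega>) * g)) \<partial>M) \<partial>lborel)"
    by (rule Fubini' [symmetric]) measurable
  \<comment> \<open>The threshold 3/4 on \<open>s\<^sup>2 * V\<close> leaves the exponent 3/8 g^2,
    still integrable against exp (-g^2 / 2), and the resulting value 1 / sqrt (1/4) is the 2 of the
    claim.\<close>
  also have "\<dots> \<le> (\<integral>\<^sup>+g. ennreal (normal_density 0 1 g) * ennreal (exp (3 / 8 * g\<^sup>2)) \<partial>lborel)"
  proof (intro nn_integral_mono)
    fix g :: real
    have "(\<integral>\<^sup>+\<omega>. ennreal (normal_density 0 1 g) * ennreal (exp ((s * Y \<omega>) * g)) \<partial>M)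
      = ennreal (normal_density 0 1 g) * (\<integral>\<^sup>+\<omega>. ennreal (exp ((s * g) * Y \<omega>)) \<partial>M)"
      by (subst nn_integral_cmult) (auto simp: mult_ac)
    also have "\<dots> \<le> ennreal (normal_density 0 1 g) * ennreal (exp (3 / 8 * g\<^sup>2))"
    proof (intro mult_left_mono order_trans [OF sub] ennreal_leI)
      have "s\<^sup>2 * V * g\<^sup>2 \<le> 3 / 4 * g\<^sup>2" using V by (intro mult_right_mono) auto
      then show "exp ((s * g)\<^sup>2 * V / 2) \<le> exp (3 / 8 * g\<^sup>2)"
        by (simp add: power_mult_distrib algebra_simps)
    qed auto
    finally show "(\<integral>\<^sup>+\<omega>. ennreal (normal_density 0 1 g) * ennreal (exp ((s * Y \<omega>) * g)) \<partial>M)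
      \<le> ennreal (normal_density 0 1 g) * ennreal (exp (3 / 8 * g\<^sup>2))" .
  qed
  also have "\<dots> = ennreal (1 / sqrt (1 - 2 * (3 / 8) * 1\<^sup>2))"
    by (rule nn_integral_exp_square_normal) auto
  also have "\<dots> = 2"
    by (simp add: real_sqrt_divide)
  finally show ?thesis .
qed

section \<open>Adapted sums against independent Gaussian increments\<close>

text \<open>Discrete time: \<open>G k\<close> is the information at the k-th grid point and
  \<open>\<xi> k\<close> the noise of the step that follows it, so \<open>\<xi> k\<close> is
  independent of \<open>G k\<close> and known only at \<open>Suc k\<close>.\<close>

locale gaussian_increments = prob_space M for M :: "'a measure" +
  fixes G :: "nat \<Rightarrow> 'a measure" and \<xi> :: "nat \<Rightarrow> 'a \<Rightarrow> real" and n :: nat and \<Delta> :: real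
  assumes step_pos: "0 < \<Delta>"
    and subalg: "k \<le> n \<Longrightarrow> subalgebra M (G k)"
    and sets_mono: "j \<le> k \<Longrightarrow> k \<le> n \<Longrightarrow> sets (G j) \<subseteq> sets (G k)"
    and adapted: "k < n \<Longrightarrow> \<xi> k \<in> borel_measurable (G (Suc k))"
    and normal: "k < n \<Longrightarrow> distributed M lborel (\<xi> k) (\<lambda>y. ennreal (normal_density 0 (sqrt \<Delta>) y))"
    and indep: "k < n \<Longrightarrow> indep_set (sets (G k)) {\<xi> k -` A \<inter> space M | A. A \<in> sets borel}"
begin

lemma measurable_G_mono:
  assumes "f \<in> G j \<rightarrow>\<^sub>M N" "j \<le> k" "k \<le> n"
  shows "f \<in> G k \<rightarrow>\<^sub>M N"
proof -
  have "subalgebra (G k) (G j)"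
    using subalg[of j] subalg[of k] sets_mono[of j k] assms(2,3) by (auto simp: subalgebra_def)
  then show ?thesis using assms(1) by (rule measurable_from_subalg)
qed

lemma measurable_G:
  assumes "f \<in> G k \<rightarrow>\<^sub>M N" "k \<le> n"
  shows "f \<in> M \<rightarrow>\<^sub>M N"
  using measurable_from_subalg[OF subalg[OF assms(2)] assms(1)] .

text \<open>Conditioning on \<open>G k\<close> in the form of Fubini: by independence the joint law
  of the identity map into \<open>G k\<close> and of \<open>\<xi> k\<close> is a product, so the
  increment can be integrated out with \<open>\<omega>\<close> frozen.\<close>

lemma nn_integral_increment:
  assumes k: "k < n" and h [measurable]: "h \<in> borel_measurable (G k \<Otimes>\<^sub>M borel)"
  shows "(\<integral>\<^sup>+\<omega>. h (\<omega>, \<xi> k \<omega>) \<partial>M)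
    = (\<integral>\<^sup>+\<omega>. (\<integral>\<^sup>+y. ennreal (normal_density 0 (sqrt \<Delta>) y) * h (\<omega>, y) \<partial>lborel) \<partial>M)"
proof -
  have sp: "space (G k) = space M" and se: "sets (G k) \<subseteq> sets M"
    using subalg[of k] k by (auto simp: subalgebra_def)
  have id: "(\<lambda>\<omega>. \<omega>) \<in> M \<rightarrow>\<^sub>M G k"
    using measurable_G[OF measurable_ident] k by (auto simp: id_def)
  have xi: "\<xi> k \<in> borel_measurable M"
    using measurable_G[OF adapted[OF k]] k by auto
  interpret X: prob_space "distr M borel (\<xi> k)" by (rule prob_space_distr) (rule xi)
  interpret I: prob_space "distr M (G k) (\<lambda>\<omega>. \<omega>)" by (rule prob_space_distr) (rule id)
  have eq: "distr M (G k) (\<lambda>\<omega>. \<omega>) \<Otimes>\<^sub>M distr M borel (\<xi> k)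
      = distr M (G k \<Otimes>\<^sub>M borel) (\<lambda>\<omega>. (\<omega>, \<xi> k \<omega>))"
  proof (rule pair_measure_eqI)
    fix A B assume "A \<in> sets (distr M (G k) (\<lambda>\<omega>. \<omega>))" "B \<in> sets (distr M borel (\<xi> k))"
    then have A: "A \<in> sets (G k)" and B: "B \<in> sets borel" by auto
    have "A \<subseteq> space M" using sets.sets_into_space[OF A] sp by simp
    then have A': "A \<inter> space M = A"
      and AB: "(\<lambda>\<omega>. (\<omega>, \<xi> k \<omega>)) -` (A \<times> B) \<inter> space M = A \<inter> (\<xi> k -` B \<inter> space M)"
      by auto
    have "prob (A \<inter> (\<xi> k -` B \<inter> space M)) = prob A * prob (\<xi> k -` B \<inter> space M)"
      using A B by (intro indep_setD[OF indep[OF k]]) auto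
    then show "emeasure (distr M (G k) (\<lambda>\<omega>. \<omega>)) A * emeasure (distr M borel (\<xi> k)) B
      = emeasure (distr M (G k \<Otimes>\<^sub>M borel) (\<lambda>\<omega>. (\<omega>, \<xi> k \<omega>))) (A \<times> B)"
      using A B id xi
      by (simp add: emeasure_distr AB A' emeasure_eq_measure ennreal_mult [symmetric])
  qed (auto intro: X.sigma_finite_measure I.sigma_finite_measure)
  have d: "distr M borel (\<xi> k) = density lborel (\<lambda>y. ennreal (normal_density 0 (sqrt \<Delta>) y))"
    using distributed_distr_eq_density[OF normal[OF k]]
    by (metis distr_cong sets_lborel)
  have h': "h \<in> borel_measurable (distr M (G k) (\<lambda>\<omega>. \<omega>) \<Otimes>\<^sub>M distr M borel (\<xi> k))"
    using h by (simp add: eq)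
  have "(\<integral>\<^sup>+\<omega>. h (\<omega>, \<xi> k \<omega>) \<partial>M) = (\<integral>\<^sup>+z. h z \<partial>distr M (G k \<Otimes>\<^sub>M borel) (\<lambda>\<omega>. (\<omega>, \<xi> k \<omega>)))"
    using id xi by (subst nn_integral_distr) auto
  also have "\<dots> = (\<integral>\<^sup>+\<omega>. (\<integral>\<^sup>+y. h (\<omega>, y) \<partial>distr M borel (\<xi> k)) \<partial>distr M (G k) (\<lambda>\<omega>. \<omega>))"
    unfolding eq [symmetric] by (rule X.nn_integral_fst [symmetric, OF h'])
  also have "\<dots> = (\<integral>\<^sup>+\<omega>. (\<integral>\<^sup>+y. h (\<omega>, y) \<partial>distr M borel (\<xi> k)) \<partial>M)"
    using id by (subst nn_integral_distr) (auto intro!: X.borel_measurable_nn_integral_fst simp: h)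
  also have "\<dots> = (\<integral>\<^sup>+\<omega>. (\<integral>\<^sup>+y. ennreal (normal_density 0 (sqrt \<Delta>) y) * h (\<omega>, y) \<partial>lborel) \<partial>M)"
    unfolding d using sp
    by (intro nn_integral_cong nn_integral_density) (auto intro!: measurable_compose[OF measurable_Pair1' h])
  finally show ?thesis .
qed

text \<open>The partial products form a nonnegative supermartingale started at 1; the induction
  integrates out the last increment.\<close>

lemma nn_integral_prod_le_1:
  assumes g: "\<And>k. k < n \<Longrightarrow> g k \<in> borel_measurable (G k \<Otimes>\<^sub>M borel)"
    and le: "\<And>k \<omega>. k < n \<Longrightarrow> \<omega> \<in> space M \<Longrightarrow>
      (\<integral>\<^sup>+y. ennreal (normal_density 0 (sqrt \<Delta>) y) * g k (\<omega>, y) \<partial>lborel) \<le> 1"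
    and "m \<le> n"
  shows "(\<integral>\<^sup>+\<omega>. (\<Prod>k<m. g k (\<omega>, \<xi> k \<omega>)) \<partial>M) \<le> (1 :: ennreal)"
  using \<open>m \<le> n\<close>
proof (induction m)
  case 0
  then show ?case by (simp add: emeasure_space_1)
next
  case (Suc m)
  \<comment> \<open>The earlier factors involve only increments before step \<open>m\<close>, so
    they are \<open>G m\<close>-measurable and act as constants when \<open>\<xi> m\<close> is
    integrated out.\<close>
  have meas: "(\<lambda>\<omega>. \<Prod>k<m. g k (\<omega>, \<xi> k \<omega>)) \<in> borel_measurable (G m)"
  proof (intro borel_measurable_prod_ennreal)
    fix k assume "k \<in> {..<m}"
    then have k: "k < m" by simp
    have "(\<lambda>\<omega>. \<omega>) \<in> G m \<rightarrow>\<^sub>M G k"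
      using measurable_G_mono[OF measurable_ident, of k m] k Suc.prems by (auto simp: id_def)
    moreover have "\<xi> k \<in> borel_measurable (G m)"
      by (rule measurable_G_mono[OF adapted]) (use k Suc.prems in auto)
    ultimately show "(\<lambda>\<omega>. g k (\<omega>, \<xi> k \<omega>)) \<in> borel_measurable (G m)"
      using k Suc.prems by (intro measurable_compose[OF measurable_Pair g]) auto
  qed
  have m: "m < n" using Suc.prems by simp
  note [measurable] = meas g[OF m]
  have sp: "space (G m) = space M" using subalg[of m] m by (auto simp: subalgebra_def)
  have "(\<integral>\<^sup>+\<omega>. (\<Prod>k<Suc m. g k (\<omega>, \<xi> k \<omega>)) \<partial>M)
      = (\<integral>\<^sup>+\<omega>. (\<lambda>(\<omega>', y). (\<Prod>k<m. g k (\<omega>', \<xi> k \<omega>')) * g m (\<omega>', y)) (\<omega>, \<xi> m \<omega>) \<partial>M)"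
    by simp
  also have "\<dots> = (\<integral>\<^sup>+\<omega>. (\<integral>\<^sup>+y. ennreal (normal_density 0 (sqrt \<Delta>) y) *
      (\<lambda>(\<omega>', y). (\<Prod>k<m. g k (\<omega>', \<xi> k \<omega>')) * g m (\<omega>', y)) (\<omega>, y) \<partial>lborel) \<partial>M)"
    by (rule nn_integral_increment[OF m]) measurable
  also have "\<dots> \<le> (\<integral>\<^sup>+\<omega>. (\<Prod>k<m. g k (\<omega>, \<xi> k \<omega>)) \<partial>M)"
  proof (intro nn_integral_mono)
    fix \<omega> assume \<omega>: "\<omega> \<in> space M"
    then have [measurable]: "(\<lambda>y. g m (\<omega>, y)) \<in> borel_measurable borel"
      using sp by (intro measurable_compose[OF measurable_Pair1' g[OF m]]) auto
    have "(\<integral>\<^sup>+y. ennreal (normal_density 0 (sqrt \<Delta>) y) *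
        ((\<Prod>k<m. g k (\<omega>, \<xi> k \<omega>)) * g m (\<omega>, y)) \<partial>lborel)
      = (\<Prod>k<m. g k (\<omega>, \<xi> k \<omega>)) *
        (\<integral>\<^sup>+y. ennreal (normal_density 0 (sqrt \<Delta>) y) * g m (\<omega>, y) \<partial>lborel)"
      by (subst nn_integral_cmult [symmetric]) (auto simp: mult_ac)
    also have "\<dots> \<le> (\<Prod>k<m. g k (\<omega>, \<xi> k \<omega>)) * 1"
      using le[OF m \<omega>] by (intro mult_left_mono) auto
    finally show "(\<integral>\<^sup>+y. ennreal (normal_density 0 (sqrt \<Delta>) y) *
        (\<lambda>(\<omega>', y). (\<Prod>k<m. g k (\<omega>', \<xi> k \<omega>')) * g m (\<omega>', y)) (\<omega>, y) \<partial>lborel)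
      \<le> (\<Prod>k<m. g k (\<omega>, \<xi> k \<omega>))" by simp
  qed
  also have "\<dots> \<le> 1" using Suc by simp
  finally show ?case .
qed

text \<open>Discrete exponential martingale. Each factor has conditional mean exactly 1 whatever the
  value of \<open>b k\<close>, so the adapted coefficients may be unbounded; for the quadratic form
  they are themselves inner sums of Gaussians.\<close>

lemma nn_integral_exp_linear_le_1:
  assumes b: "\<And>k. k < n \<Longrightarrow> b k \<in> borel_measurable (G k)" and "m \<le> n"
  shows "(\<integral>\<^sup>+\<omega>. ennreal (exp ((\<Sum>k<m. b k \<omega> * \<xi> k \<omega>) - (\<Sum>k<m. (b k \<omega>)\<^sup>2) * \<Delta> / 2)) \<partial>M) \<le> 1"
proof -
  define g where "g = (\<lambda>k (\<omega>, y). ennreal (exp (- ((b k \<omega>)\<^sup>2 * \<Delta> / 2))) * ennreal (exp (b k \<omega> * y)))"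
  have "(\<integral>\<^sup>+\<omega>. (\<Prod>k<m. g k (\<omega>, \<xi> k \<omega>)) \<partial>M) \<le> 1"
  proof (rule nn_integral_prod_le_1[OF _ _ \<open>m \<le> n\<close>])
    fix k assume k: "k < n"
    note [measurable] = b[OF k]
    show "g k \<in> borel_measurable (G k \<Otimes>\<^sub>M borel)"
      unfolding g_def by measurable
    fix \<omega> assume "\<omega> \<in> space M"
    have "(\<integral>\<^sup>+y. ennreal (normal_density 0 (sqrt \<Delta>) y) * g k (\<omega>, y) \<partial>lborel)
      = ennreal (exp (- ((b k \<omega>)\<^sup>2 * \<Delta> / 2))) *
        (\<integral>\<^sup>+y. ennreal (normal_density 0 (sqrt \<Delta>) y) * ennreal (exp (b k \<omega> * y)) \<partial>lborel)"
      unfolding g_def by (subst nn_integral_cmult [symmetric]) (auto simp: mult_ac)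
    also have "\<dots> = 1"
      using step_pos by (subst nn_integral_exp_linear_normal)
        (auto simp: ennreal_mult [symmetric] exp_add [symmetric])
    finally show "(\<integral>\<^sup>+y. ennreal (normal_density 0 (sqrt \<Delta>) y) * g k (\<omega>, y) \<partial>lborel) \<le> 1"
      by simp
  qed
  moreover have "(\<Prod>k<m. g k (\<omega>, \<xi> k \<omega>))
      = ennreal (exp ((\<Sum>k<m. b k \<omega> * \<xi> k \<omega>) - (\<Sum>k<m. (b k \<omega>)\<^sup>2) * \<Delta> / 2))" for \<omega>
    unfolding g_def by (simp add: ennreal_mult [symmetric] exp_add [symmetric] prod_ennreal
        exp_sum [symmetric] sum_subtractf sum_distrib_right sum_divide_distrib)
  ultimately show ?thesis by simp
qed

text \<open>Each step is compensated by 4 b^2 \<Delta>^2 to obtain a supermartingale; as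
  \<bar>b\<bar> \<le> B, the total compensator is at most the deterministic exponent on the right
  and can be taken out of the integral.\<close>

lemma nn_integral_exp_centred_squares_le:
  fixes B :: real
  assumes b: "\<And>k. k < n \<Longrightarrow> b k \<in> borel_measurable (G k)"
    and bound: "\<And>k \<omega>. k < n \<Longrightarrow> \<omega> \<in> space M \<Longrightarrow> \<bar>b k \<omega>\<bar> \<le> B" and B: "B * \<Delta> \<le> 1 / 4"
  shows "(\<integral>\<^sup>+\<omega>. ennreal (exp (\<Sum>k<n. b k \<omega> * ((\<xi> k \<omega>)\<^sup>2 - \<Delta>))) \<partial>M)
    \<le> ennreal (exp (4 * n * B\<^sup>2 * \<Delta>\<^sup>2))"
proof -
  define g where "g = (\<lambda>k (\<omega>, y). ennreal (exp (b k \<omega> * (y\<^sup>2 - \<Delta>) - 4 * (b k \<omega>)\<^sup>2 * \<Delta>\<^sup>2)))"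
  have *: "(\<integral>\<^sup>+\<omega>. (\<Prod>k<n. g k (\<omega>, \<xi> k \<omega>)) \<partial>M) \<le> 1"
  proof (rule nn_integral_prod_le_1)
    fix k assume k: "k < n"
    note [measurable] = b[OF k]
    show "g k \<in> borel_measurable (G k \<Otimes>\<^sub>M borel)"
      unfolding g_def by measurable
    fix \<omega> assume "\<omega> \<in> space M"
    then have "\<bar>b k \<omega>\<bar> * \<Delta> \<le> B * \<Delta>"
      using bound[OF k] step_pos by (intro mult_right_mono) auto
    from order_trans[OF this B] have "\<bar>b k \<omega>\<bar> * (sqrt \<Delta>)\<^sup>2 \<le> 1 / 4"
      using step_pos by simp
    then show "(\<integral>\<^sup>+y. ennreal (normal_density 0 (sqrt \<Delta>) y) * g k (\<omega>, y) \<partial>lborel) \<le> 1"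
      using nn_integral_exp_centred_square_normal_le[of "sqrt \<Delta>" "b k \<omega>"] step_pos
      by (simp add: g_def)
  qed simp
  have "(\<integral>\<^sup>+\<omega>. ennreal (exp (\<Sum>k<n. b k \<omega> * ((\<xi> k \<omega>)\<^sup>2 - \<Delta>))) \<partial>M)
      \<le> (\<integral>\<^sup>+\<omega>. ennreal (exp (4 * n * B\<^sup>2 * \<Delta>\<^sup>2)) * (\<Prod>k<n. g k (\<omega>, \<xi> k \<omega>)) \<partial>M)"
  proof (intro nn_integral_mono)
    fix \<omega> assume \<omega>: "\<omega> \<in> space M"
    have "(\<Sum>k<n. 4 * (b k \<omega>)\<^sup>2 * \<Delta>\<^sup>2) \<le> (\<Sum>k<n. 4 * B\<^sup>2 * \<Delta>\<^sup>2)"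
      using bound \<omega> by (intro sum_mono mult_right_mono mult_left_mono)
        (auto intro!: power2_le_iff_abs_le [THEN iffD2] order_trans [OF abs_ge_zero])
    then have "exp (\<Sum>k<n. b k \<omega> * ((\<xi> k \<omega>)\<^sup>2 - \<Delta>))
      \<le> exp (4 * n * B\<^sup>2 * \<Delta>\<^sup>2) * exp (\<Sum>k<n. b k \<omega> * ((\<xi> k \<omega>)\<^sup>2 - \<Delta>) - 4 * (b k \<omega>)\<^sup>2 * \<Delta>\<^sup>2)"
      by (simp add: exp_add [symmetric] sum_subtractf)
    then show "ennreal (exp (\<Sum>k<n. b k \<omega> * ((\<xi> k \<omega>)\<^sup>2 - \<Delta>)))
      \<le> ennreal (exp (4 * n * B\<^sup>2 * \<Delta>\<^sup>2)) * (\<Prod>k<n. g k (\<omega>, \<xi> k \<omega>))"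
      by (simp add: g_def prod_ennreal exp_sum [symmetric] ennreal_mult [symmetric])
  qed
  also have "\<dots> = ennreal (exp (4 * n * B\<^sup>2 * \<Delta>\<^sup>2)) * (\<integral>\<^sup>+\<omega>. (\<Prod>k<n. g k (\<omega>, \<xi> k \<omega>)) \<partial>M)"
  proof (intro nn_integral_cmult borel_measurable_prod_ennreal)
    fix k assume "k \<in> {..<n}"
    then have k: "k < n" by simp
    have [measurable]: "b k \<in> borel_measurable M" "\<xi> k \<in> borel_measurable M"
      using measurable_G[OF b[OF k]] measurable_G[OF adapted[OF k]] k by auto
    show "(\<lambda>\<omega>. g k (\<omega>, \<xi> k \<omega>)) \<in> borel_measurable M"
      unfolding g_def by simp
  qed
  also have "\<dots> \<le> ennreal (exp (4 * n * B\<^sup>2 * \<Delta>\<^sup>2)) * 1"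
    using * by (intro mult_left_mono) auto
  finally show ?thesis by simp
qed

end

text \<open>Jensen for the uniform average. It replaces the exponential of a time average by an
  average of exponentials, so that the inner sums need to be controlled only one at a time.\<close>

lemma exp_mean_le:
  fixes f :: "nat \<Rightarrow> real"
  assumes "0 < n"
  shows "exp ((\<Sum>k<n. f k) / n) \<le> (\<Sum>k<n. exp (f k)) / n"
proof -
  have "exp (\<Sum>k<n. (1 / n) *\<^sub>R f k) \<le> (\<Sum>k<n. (1 / n) * exp (f k))"
    using assms by (intro convex_on_sum[OF _ _ exp_convex]) auto
  then show ?thesis by (simp add: sum_divide_distrib)
qed

context gaussian_increments
begin

text \<open>A deterministic bound \<open>V\<close> on the bracket turns the exponential
  supermartingale into a subgaussian estimate with variance proxy \<open>V\<close>.\<close>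

lemma nn_integral_exp_linear_bounded_le:
  assumes b: "\<And>k. k < n \<Longrightarrow> b k \<in> borel_measurable (G k)" and "m \<le> n"
    and V: "\<And>\<omega>. \<omega> \<in> space M \<Longrightarrow> (\<Sum>k<m. (b k \<omega>)\<^sup>2) * \<Delta> \<le> V"
  shows "(\<integral>\<^sup>+\<omega>. ennreal (exp (l * (\<Sum>k<m. b k \<omega> * \<xi> k \<omega>))) \<partial>M) \<le> ennreal (exp (l\<^sup>2 * V / 2))"
proof -
  define S where "S = (\<lambda>\<omega>. (\<Sum>k<m. (l * b k \<omega>) * \<xi> k \<omega>) - (\<Sum>k<m. (l * b k \<omega>)\<^sup>2) * \<Delta> / 2)"
  have [measurable]: "b k \<in> borel_measurable M" "\<xi> k \<in> borel_measurable M" if "k \<in> {..<m}" for k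
    using that measurable_G[OF b] measurable_G[OF adapted] \<open>m \<le> n\<close> by auto
  have [measurable]: "S \<in> borel_measurable M"
    unfolding S_def by measurable
  have "(\<integral>\<^sup>+\<omega>. ennreal (exp (S \<omega>)) \<partial>M) \<le> 1"
    unfolding S_def by (rule nn_integral_exp_linear_le_1[OF _ \<open>m \<le> n\<close>]) (use b in measurable)
  moreover have "(\<integral>\<^sup>+\<omega>. ennreal (exp (l * (\<Sum>k<m. b k \<omega> * \<xi> k \<omega>))) \<partial>M)
      \<le> (\<integral>\<^sup>+\<omega>. ennreal (exp (l\<^sup>2 * V / 2)) * ennreal (exp (S \<omega>)) \<partial>M)"
  proof (intro nn_integral_mono)
    fix \<omega> assume \<omega>: "\<omega> \<in> space M"
    have "l * (\<Sum>k<m. b k \<omega> * \<xi> k \<omega>) = l\<^sup>2 * ((\<Sum>k<m. (b k \<omega>)\<^sup>2) * \<Delta>) / 2 + S \<omega>"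
      unfolding S_def by (simp add: sum_distrib_left sum_distrib_right power_mult_distrib mult_ac)
    also have "\<dots> \<le> l\<^sup>2 * V / 2 + S \<omega>"
      using V[OF \<omega>] by (intro add_right_mono divide_right_mono mult_left_mono) auto
    finally show "ennreal (exp (l * (\<Sum>k<m. b k \<omega> * \<xi> k \<omega>)))
        \<le> ennreal (exp (l\<^sup>2 * V / 2)) * ennreal (exp (S \<omega>))"
      by (simp add: ennreal_mult [symmetric] exp_add [symmetric])
  qed
  moreover have "\<dots> = ennreal (exp (l\<^sup>2 * V / 2)) * (\<integral>\<^sup>+\<omega>. ennreal (exp (S \<omega>)) \<partial>M)"
    by (rule nn_integral_cmult) measurable
  ultimately show ?thesis
    using mult_left_mono[of "\<integral>\<^sup>+\<omega>. ennreal (exp (S \<omega>)) \<partial>M" 1 "ennreal (exp (l\<^sup>2 * V / 2))"]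
    by (auto intro: order_trans)
qed

text \<open>The exponent \<open>A\<close> is split as \<open>(A - B) + B\<close>, where \<open>2 A - 2 B\<close> is the logarithm of an
  exponential supermartingale and \<open>2 B\<close> is quadratic in the subgaussian inner sums.\<close>

lemma nn_integral_exp_quadratic_form_le:
  fixes a :: "nat \<Rightarrow> 'a \<Rightarrow> real" and c :: "nat \<Rightarrow> nat \<Rightarrow> real"
  assumes n: "0 < n" and a: "\<And>k. k < n \<Longrightarrow> a k \<in> borel_measurable (G k)"
    and bound: "\<And>k \<omega>. k < n \<Longrightarrow> \<omega> \<in> space M \<Longrightarrow> \<bar>a k \<omega>\<bar> \<le> m"
    and V: "\<And>k. k < n \<Longrightarrow> (\<Sum>j<k. (c j k)\<^sup>2) * \<Delta> \<le> V"
    and l: "4 * l\<^sup>2 * m ^ 4 * (n * \<Delta>) * V \<le> 3 / 4"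
  shows "(\<integral>\<^sup>+\<omega>. ennreal (exp (l * (\<Sum>k<n. \<Sum>j<k. c j k * (a j \<omega> * \<xi> j \<omega>) * (a k \<omega> * \<xi> k \<omega>)))) \<partial>M) \<le> 3"
proof -
  define Y where "Y = (\<lambda>k \<omega>. \<Sum>j<k. (c j k * a j \<omega>) * \<xi> j \<omega>)"
  \<comment> \<open>Chosen so that \<open>2 * B\<close> below is at most the average over
    \<open>k\<close> of s^2 Y_k^2 / 2, using \<bar>a\<bar> \<le> m; the hypothesis on
    \<open>l\<close> then says exactly that s^2 times the variance proxy
    \<open>m\<^sup>2 * V\<close> of \<open>Y k\<close> is at most 3/4.\<close>
  define s where "s = sqrt (4 * l\<^sup>2 * m\<^sup>2 * (n * \<Delta>))"
  have s: "s\<^sup>2 = 4 * l\<^sup>2 * m\<^sup>2 * (n * \<Delta>)"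
    using step_pos by (simp add: s_def)
  have a_M [measurable]: "a k \<in> borel_measurable M" "\<xi> k \<in> borel_measurable M" if "k < n" for k
    using that measurable_G[OF a] measurable_G[OF adapted] by auto
  have Y_G: "Y k \<in> borel_measurable (G k)" if "k < n" for k
  proof -
    have [measurable]: "a j \<in> borel_measurable (G k)" "\<xi> j \<in> borel_measurable (G k)" if "j \<in> {..<k}" for j
      using that \<open>k < n\<close> measurable_G_mono[OF a[of j], of k] measurable_G_mono[OF adapted[of j], of k]
      by auto
    show ?thesis unfolding Y_def by measurable
  qed
  have Y_M: "Y k \<in> borel_measurable M" if "k < n" for k
    using measurable_G[OF Y_G] that by auto
  have Y_sq: "(\<integral>\<^sup>+\<omega>. ennreal (exp (s\<^sup>2 * (Y k \<omega>)\<^sup>2 / 2)) \<partial>M) \<le> 2" if k: "k < n" for k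
  proof (rule nn_integral_exp_square_subgaussian[where V = "m\<^sup>2 * V"])
    show "sigma_finite_measure M" ..
    show "Y k \<in> borel_measurable M" by (rule Y_M[OF k])
    show "s\<^sup>2 * (m\<^sup>2 * V) \<le> 3 / 4"
      using l unfolding s by (simp add: power2_eq_square power4_eq_xxxx mult_ac)
    fix l'
    show "(\<integral>\<^sup>+\<omega>. ennreal (exp (l' * Y k \<omega>)) \<partial>M) \<le> ennreal (exp (l'\<^sup>2 * (m\<^sup>2 * V) / 2))"
      unfolding Y_def
    proof (rule nn_integral_exp_linear_bounded_le)
      show "(\<lambda>\<omega>. c j k * a j \<omega>) \<in> borel_measurable (G j)" if "j < n" for j
        using a[OF that] by measurable
      show "k \<le> n" using k by simp
      fix \<omega> assume \<omega>: "\<omega> \<in> space M"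
      have "(\<Sum>j<k. (c j k * a j \<omega>)\<^sup>2) \<le> (\<Sum>j<k. m\<^sup>2 * (c j k)\<^sup>2)"
      proof (rule sum_mono)
        fix j assume "j \<in> {..<k}"
        then have "\<bar>a j \<omega>\<bar> \<le> m" using bound[of j \<omega>] k \<omega> by simp
        then have "(a j \<omega>)\<^sup>2 \<le> m\<^sup>2" by (metis abs_ge_self abs_le_square_iff order_trans)
        then show "(c j k * a j \<omega>)\<^sup>2 \<le> m\<^sup>2 * (c j k)\<^sup>2"
          by (simp add: power_mult_distrib mult_right_mono mult.commute)
      qed
      then have "(\<Sum>j<k. (c j k * a j \<omega>)\<^sup>2) * \<Delta> \<le> (\<Sum>j<k. m\<^sup>2 * (c j k)\<^sup>2) * \<Delta>"
        using step_pos by (intro mult_right_mono) auto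
      also have "\<dots> = m\<^sup>2 * ((\<Sum>j<k. (c j k)\<^sup>2) * \<Delta>)"
        by (simp add: sum_distrib_left mult.assoc)
      also have "\<dots> \<le> m\<^sup>2 * V"
        using V[OF k] by (intro mult_left_mono) auto
      finally show "(\<Sum>j<k. (c j k * a j \<omega>)\<^sup>2) * \<Delta> \<le> m\<^sup>2 * V" .
    qed
  qed
  define D where "D = (\<lambda>\<omega>. (\<Sum>k<n. (2 * l * (a k \<omega> * Y k \<omega>)) * \<xi> k \<omega>)
    - (\<Sum>k<n. (2 * l * (a k \<omega> * Y k \<omega>))\<^sup>2) * \<Delta> / 2)"
  have "(\<lambda>\<omega>. 2 * l * (a k \<omega> * Y k \<omega>)) \<in> borel_measurable (G k)" if "k < n" for k
    using a[OF that] Y_G[OF that] by measurable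
  then have D: "(\<integral>\<^sup>+\<omega>. ennreal (exp (D \<omega>)) \<partial>M) \<le> 1"
    unfolding D_def by (intro nn_integral_exp_linear_le_1[where b = "\<lambda>k \<omega>. 2 * l * (a k \<omega> * Y k \<omega>)"]) auto
  have D_M [measurable]: "D \<in> borel_measurable M"
    unfolding D_def using Y_M a_M by (intro borel_measurable_diff borel_measurable_sum borel_measurable_times
      borel_measurable_divide borel_measurable_power borel_measurable_const) auto
  have "(\<integral>\<^sup>+\<omega>. ennreal (exp (l * (\<Sum>k<n. \<Sum>j<k. c j k * (a j \<omega> * \<xi> j \<omega>) * (a k \<omega> * \<xi> k \<omega>)))) \<partial>M)
    \<le> (\<integral>\<^sup>+\<omega>. (ennreal (exp (D \<omega>)) + (\<Sum>k<n. ennreal (1 / n) * ennreal (exp (s\<^sup>2 * (Y k \<omega>)\<^sup>2 / 2)))) \<partial>M)"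
  proof (intro nn_integral_mono)
    fix \<omega> assume \<omega>: "\<omega> \<in> space M"
    define A where "A = l * (\<Sum>k<n. \<Sum>j<k. c j k * (a j \<omega> * \<xi> j \<omega>) * (a k \<omega> * \<xi> k \<omega>))"
    define B where "B = (\<Sum>k<n. (2 * l * (a k \<omega> * Y k \<omega>))\<^sup>2) * \<Delta> / 4"
    have A: "2 * A = D \<omega> + 2 * B"
      unfolding A_def B_def D_def Y_def by (simp add: sum_distrib_left sum_distrib_right mult_ac)
    have "2 * B \<le> (\<Sum>k<n. s\<^sup>2 * (Y k \<omega>)\<^sup>2 / 2) / n"
    proof -
      have "(\<Sum>k<n. (2 * l * (a k \<omega> * Y k \<omega>))\<^sup>2) \<le> (\<Sum>k<n. 4 * l\<^sup>2 * m\<^sup>2 * (Y k \<omega>)\<^sup>2)"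
      proof (rule sum_mono)
        fix k assume "k \<in> {..<n}"
        then have "\<bar>a k \<omega>\<bar> \<le> m" using bound[of k \<omega>] \<omega> by simp
        then have "(a k \<omega>)\<^sup>2 \<le> m\<^sup>2" by (metis abs_ge_self abs_le_square_iff order_trans)
        then have "(4 * l\<^sup>2 * (Y k \<omega>)\<^sup>2) * (a k \<omega>)\<^sup>2 \<le> (4 * l\<^sup>2 * (Y k \<omega>)\<^sup>2) * m\<^sup>2"
          by (rule mult_left_mono) simp
        then show "(2 * l * (a k \<omega> * Y k \<omega>))\<^sup>2 \<le> 4 * l\<^sup>2 * m\<^sup>2 * (Y k \<omega>)\<^sup>2"
          by (simp add: power_mult_distrib mult_ac)
      qed
      then have "2 * B \<le> (\<Sum>k<n. 4 * l\<^sup>2 * m\<^sup>2 * (Y k \<omega>)\<^sup>2) * \<Delta> / 2"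
        unfolding B_def using step_pos by (simp add: mult_right_mono)
      also have "\<dots> = (\<Sum>k<n. s\<^sup>2 * (Y k \<omega>)\<^sup>2 / 2) / n"
        unfolding s using n by (simp add: sum_distrib_left sum_distrib_right sum_divide_distrib mult_ac)
      finally show ?thesis .
    qed
    then have B: "exp (2 * B) \<le> (\<Sum>k<n. exp (s\<^sup>2 * (Y k \<omega>)\<^sup>2 / 2)) / n"
      using exp_mean_le[OF n, of "\<lambda>k. s\<^sup>2 * (Y k \<omega>)\<^sup>2 / 2"] by (meson exp_le_cancel_iff order_trans)
    \<comment> \<open>xy \<le> x^2 + y^2 takes the place of Cauchy-Schwarz: the two factors are
      dependent, but the square of each has its own moment bound, 1 for exp D and 2 for exp (2
      B).\<close>
    have "exp A = exp (D \<omega> / 2) * exp B"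
      using A by (simp add: exp_add [symmetric])
    also have "\<dots> \<le> exp (D \<omega> / 2) ^ 2 + exp B ^ 2"
      using sum_squares_bound[of "exp (D \<omega> / 2)" "exp B"] mult_pos_pos[OF exp_gt_zero[of "D \<omega> / 2"] exp_gt_zero[of B]]
      by linarith
    also have "\<dots> = exp (D \<omega>) + exp (2 * B)"
      by (simp add: exp_double [symmetric])
    also have "\<dots> \<le> exp (D \<omega>) + (\<Sum>k<n. (1 / n) * exp (s\<^sup>2 * (Y k \<omega>)\<^sup>2 / 2))"
      using B by (simp add: sum_divide_distrib)
    finally have "ennreal (exp A) \<le> ennreal (exp (D \<omega>) + (\<Sum>k<n. (1 / n) * exp (s\<^sup>2 * (Y k \<omega>)\<^sup>2 / 2)))"
      by (rule ennreal_leI)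
    also have "\<dots> = ennreal (exp (D \<omega>)) + (\<Sum>k<n. ennreal ((1 / n) * exp (s\<^sup>2 * (Y k \<omega>)\<^sup>2 / 2)))"
      by (subst ennreal_plus) (auto intro!: sum_nonneg simp: sum_ennreal)
    finally show "ennreal (exp (l * (\<Sum>k<n. \<Sum>j<k. c j k * (a j \<omega> * \<xi> j \<omega>) * (a k \<omega> * \<xi> k \<omega>))))
      \<le> ennreal (exp (D \<omega>)) + (\<Sum>k<n. ennreal (1 / n) * ennreal (exp (s\<^sup>2 * (Y k \<omega>)\<^sup>2 / 2)))"
      unfolding A_def by (subst ennreal_mult [symmetric]) auto
  qed
  also have "\<dots> = (\<integral>\<^sup>+\<omega>. ennreal (exp (D \<omega>)) \<partial>M)
      + (\<Sum>k<n. ennreal (1 / n) * (\<integral>\<^sup>+\<omega>. ennreal (exp (s\<^sup>2 * (Y k \<omega>)\<^sup>2 / 2)) \<partial>M))"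
  proof -
    have [measurable]: "Y k \<in> borel_measurable M" if "k \<in> {..<n}" for k
      using Y_M that by simp
    show ?thesis
      by (subst nn_integral_add, measurable, subst nn_integral_sum, measurable)
        (simp add: nn_integral_cmult cong: sum.cong_simp)
  qed
  also have "\<dots> \<le> 1 + (\<Sum>k<n. ennreal (1 / n) * 2)"
    using D Y_sq by (intro add_mono sum_mono mult_left_mono) auto
  also have "(\<Sum>k<n. ennreal (1 / n) * 2) = 2"
  proof -
    have "(\<Sum>k<n. ennreal (1 / n)) = 1"
      using n by (subst sum_ennreal) auto
    then show ?thesis by (simp only: sum_distrib_right [symmetric] mult_1)
  qed
  finally show ?thesis by simp
qed

end

section \<open>The time grid and discrete orthogonality\<close>

definition grid :: "nat \<Rightarrow> nat \<Rightarrow> real" where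
  "grid n k = -pi + 2 * pi * real k / real n"

text \<open>Up to a phase the summands are the powers of an n-th root of unity, which is not 1
  because 0 < \<bar>q\<bar> < n.\<close>

lemma sum_cis_grid_eq_0:
  assumes "0 < n" and q: "q \<noteq> 0" "\<bar>q\<bar> < int n"
  shows "(\<Sum>j<n. cis (real_of_int q * grid n j)) = 0"
proof -
  define z where "z = cis (2 * pi * (real_of_int q / n))"
  have "cis (real_of_int q * grid n j) = cis (- real_of_int q * pi) * z ^ j" for j
    unfolding z_def Complex.DeMoivre cis_mult grid_def
    by (rule arg_cong[of _ _ cis]) (simp add: algebra_simps)
  moreover have "z \<noteq> 1"
  proof
    assume "z = 1"
    then have "cos (2 * pi * (real_of_int q / n)) = 1"
      by (simp add: z_def complex_eq_iff)
    then obtain i :: int where "2 * pi * (real_of_int q / n) = real_of_int i * 2 * pi"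
      using cos_one_2pi_int by blast
    then have "real_of_int q = real_of_int (i * int n)"
      using assms(1) by (simp add: field_simps)
    then have "q = i * int n" by linarith
    then have "int n \<le> \<bar>q\<bar>" using q(1) by (auto simp: abs_mult)
    then show False using q(2) by simp
  qed
  moreover have "z ^ n = 1"
    using assms(1) by (simp add: z_def Complex.DeMoivre cis_multiple_2pi)
  ultimately show ?thesis
    by (simp add: sum_distrib_left [symmetric] geometric_sum)
qed

text \<open>Discrete Parseval: frequencies of modulus at most \<open>N\<close> differ by at most
  \<open>2 * N\<close>, which is less than \<open>n\<close>, so distinct ones are orthogonal on the
  grid.\<close>

lemma sum_norm_trig_poly_grid:
  fixes w :: "int \<Rightarrow> complex"
  assumes "2 * N < n"
  shows "(\<Sum>j<n. (cmod (\<Sum>l\<in>{- int N..int N}. w l * cis (- real_of_int l * grid n j)))\<^sup>2)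
    = n * (\<Sum>l\<in>{- int N..int N}. (cmod (w l))\<^sup>2)"
proof -
  let ?L = "{- int N..int N}"
  have ortho: "(\<Sum>j<n. cis (real_of_int (i - l) * grid n j)) = (if i = l then of_nat n else 0)"
    if "l \<in> ?L" "i \<in> ?L" for l i
    using that assms sum_cis_grid_eq_0[of n "i - l"] by auto
  have "complex_of_real (\<Sum>j<n. (cmod (\<Sum>l\<in>?L. w l * cis (- real_of_int l * grid n j)))\<^sup>2)
    = (\<Sum>j<n. (\<Sum>l\<in>?L. w l * cis (- real_of_int l * grid n j)) *
        (\<Sum>i\<in>?L. cnj (w i) * cis (real_of_int i * grid n j)))"
    by (simp add: complex_norm_square del: of_real_power) (simp add: cis_cnj)
  also have "\<dots> = (\<Sum>j<n. \<Sum>l\<in>?L. \<Sum>i\<in>?L. w l * cnj (w i) * cis (real_of_int (i - l) * grid n j))"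
    by (intro sum.cong refl) (simp add: sum_product cis_mult algebra_simps)
  also have "\<dots> = (\<Sum>l\<in>?L. \<Sum>i\<in>?L. w l * cnj (w i) * (\<Sum>j<n. cis (real_of_int (i - l) * grid n j)))"
    by (subst sum.swap, intro sum.cong refl, subst sum.swap) (simp add: sum_distrib_left)
  also have "\<dots> = (\<Sum>l\<in>?L. \<Sum>i\<in>?L. w l * cnj (w i) * (if i = l then of_nat n else 0))"
    using ortho by (intro sum.cong refl) simp
  also have "\<dots> = (\<Sum>l\<in>?L. w l * cnj (w l) * of_nat n)"
    by (intro sum.cong refl) (simp add: if_distrib cong: if_cong)
  also have "\<dots> = complex_of_real (n * (\<Sum>l\<in>?L. (cmod (w l))\<^sup>2))"
    by (simp add: sum_distrib_left complex_norm_square mult_ac del: of_real_power)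
  finally show ?thesis
    using of_real_eq_iff by blast
qed

lemma grid_0 [simp]: "grid n 0 = -pi"
  by (simp add: grid_def)

lemma grid_self [simp]: "0 < n \<Longrightarrow> grid n n = pi"
  by (simp add: grid_def)

lemma grid_Suc_diff: "grid n (Suc k) - grid n k = 2 * pi / n"
  by (simp add: grid_def algebra_simps add_divide_distrib)

lemma grid_mono: "j \<le> k \<Longrightarrow> grid n j \<le> grid n k"
  by (simp add: grid_def divide_right_mono)

lemma grid_mem: "k \<le> n \<Longrightarrow> 0 < n \<Longrightarrow> grid n k \<in> {-pi..pi}"
  using grid_mono[of 0 k n] grid_mono[of k n n] by simp

lemma grid_interval_subset: "k < n \<Longrightarrow> {grid n k..grid n (Suc k)} \<subseteq> {-pi..pi}"
  using grid_mem[of k n] grid_mem[of "Suc k" n] by auto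

lemma integral_eq_sum_grid:
  fixes f :: "real \<Rightarrow> 'b::banach"
  assumes f: "f integrable_on {-pi..pi}" and n: "0 < n"
  shows "integral {-pi..pi} f = (\<Sum>k<n. integral {grid n k..grid n (Suc k)} f)"
proof -
  have "integral {-pi..grid n m} f = (\<Sum>k<m. integral {grid n k..grid n (Suc k)} f)" if "m \<le> n" for m
    using that
  proof (induction m)
    case (Suc m)
    have "integral {-pi..grid n m} f + integral {grid n m..grid n (Suc m)} f = integral {-pi..grid n (Suc m)} f"
    proof (rule Henstock_Kurzweil_Integration.integral_combine)
      show "-pi \<le> grid n m" "grid n m \<le> grid n (Suc m)"
        using grid_mono[of 0 m n] grid_mono[of m "Suc m" n] by auto
      show "f integrable_on {-pi..grid n (Suc m)}"
        by (rule integrable_on_subinterval[OF f]) (use grid_mem[of "Suc m" n] Suc.prems n in auto)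
    qed
    then show ?case using Suc by simp
  qed simp
  from this[of n] n show ?thesis by simp
qed

text \<open>The comparison function may change from cell to cell. It is a constant for ordinary
  Riemann sums, and an exact exponential times a frozen path value for the Stieltjes sums.\<close>

lemma norm_integral_diff_sum_grid_le:
  fixes f :: "real \<Rightarrow> 'b::banach"
  assumes f: "continuous_on {-pi..pi} f" and n: "0 < n"
    and g: "\<And>k. k < n \<Longrightarrow> continuous_on {grid n k..grid n (Suc k)} (g k)"
    and e: "\<And>k t. k < n \<Longrightarrow> t \<in> {grid n k..grid n (Suc k)} \<Longrightarrow> norm (f t - g k t) \<le> e"
  shows "norm (integral {-pi..pi} f - (\<Sum>k<n. integral {grid n k..grid n (Suc k)} (g k))) \<le> 2 * pi * e"
proof -
  have fk: "continuous_on {grid n k..grid n (Suc k)} f" if "k < n" for k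
    using f grid_interval_subset[OF that] by (rule continuous_on_subset)
  have "integral {-pi..pi} f - (\<Sum>k<n. integral {grid n k..grid n (Suc k)} (g k))
    = (\<Sum>k<n. integral {grid n k..grid n (Suc k)} (\<lambda>t. f t - g k t))"
    using n f by (simp add: integral_eq_sum_grid integrable_continuous_real sum_subtractf [symmetric]
        integral_diff fk g cong: sum.cong_simp)
  also have "norm \<dots> \<le> (\<Sum>k<n. e * (grid n (Suc k) - grid n k))"
    using e fk g by (intro sum_norm_le integral_bound continuous_on_diff) (auto intro: grid_mono)
  also have "\<dots> = 2 * pi * e"
    using n by (simp add: grid_Suc_diff)
  finally show ?thesis .
qed

lemma eventually_grid_oscillation:
  fixes f :: "real \<Rightarrow> 'b::metric_space"
  assumes f: "continuous_on {-pi..pi} f" and e: "0 < e"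
  shows "\<forall>\<^sub>F n in sequentially. 0 < n \<and> (\<forall>k<n. \<forall>s\<in>{grid n k..grid n (Suc k)}.
    \<forall>t\<in>{grid n k..grid n (Suc k)}. dist (f s) (f t) \<le> e)"
proof -
  have "uniformly_continuous_on {-pi..pi} f"
    using f by (rule compact_uniformly_continuous) simp
  then obtain d where d: "d > 0" "\<And>s t. s \<in> {-pi..pi} \<Longrightarrow> t \<in> {-pi..pi} \<Longrightarrow> dist s t < d \<Longrightarrow> dist (f s) (f t) < e"
    using e unfolding uniformly_continuous_on_def by metis
  have "(\<lambda>n. 2 * pi / real n) \<longlonglongrightarrow> 0" by real_asymp
  then have "\<forall>\<^sub>F n in sequentially. 2 * pi / real n < d"
    using d(1) by (rule order_tendstoD)
  then show ?thesis
    using eventually_gt_at_top[of 0]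
  proof eventually_elim
    case (elim n)
    have "dist (f s) (f t) \<le> e" if k: "k < n" and st: "s \<in> {grid n k..grid n (Suc k)}" "t \<in> {grid n k..grid n (Suc k)}" for k s t
    proof -
      have "dist s t \<le> grid n (Suc k) - grid n k" using st by (auto simp: dist_real_def)
      then have "dist s t < d" using elim by (simp add: grid_Suc_diff)
      then show ?thesis
        using d(2)[of s t] grid_interval_subset[OF k] st by force
    qed
    then show ?case using elim by blast
  qed
qed

lemma grid_sum_tendsto_integral:
  fixes f :: "real \<Rightarrow> complex"
  assumes f: "continuous_on {-pi..pi} f"
  shows "(\<lambda>n. \<Sum>k<n. complex_of_real (2 * pi / n) * f (grid n k)) \<longlonglongrightarrow> integral {-pi..pi} f"
proof (rule tendstoI)
  fix e :: real assume e: "0 < e"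
  have "0 < e / (4 * pi)" using e by simp
  from eventually_grid_oscillation[OF f this]
  show "\<forall>\<^sub>F n in sequentially. dist (\<Sum>k<n. complex_of_real (2 * pi / n) * f (grid n k)) (integral {-pi..pi} f) < e"
  proof eventually_elim
    case (elim n)
    have "norm (integral {-pi..pi} f - (\<Sum>k<n. integral {grid n k..grid n (Suc k)} (\<lambda>t. f (grid n k)))) \<le> 2 * pi * (e / (4 * pi))"
      using elim by (intro norm_integral_diff_sum_grid_le f) (auto simp: dist_norm grid_mono)
    moreover have "integral {grid n k..grid n (Suc k)} (\<lambda>t. f (grid n k)) = complex_of_real (2 * pi / n) * f (grid n k)" for k
    proof -
      have "integral {grid n k..grid n (Suc k)} (\<lambda>t. f (grid n k)) = (grid n (Suc k) - grid n k) *\<^sub>R f (grid n k)"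
        by (simp add: grid_mono)
      then show ?thesis by (simp only: grid_Suc_diff scaleR_conv_of_real)
    qed
    ultimately show ?case
      using e by (simp add: dist_norm norm_minus_commute)
  qed
qed

lemma cis_diff_eq_integral:
  assumes "a \<le> b"
  shows "cis (- q * b) - cis (- q * a) = - \<i> * complex_of_real q * integral {a..b} (\<lambda>t. cis (- q * t))"
proof -
  have "((\<lambda>t. - \<i> * complex_of_real q * cis (- q * t)) has_integral (cis (- q * b) - cis (- q * a))) {a..b}"
  proof (rule fundamental_theorem_of_calculus[OF assms])
    fix t
    have "((\<lambda>t. cis (- q * t)) has_derivative (\<lambda>h. (- q * h) *\<^sub>R (\<i> * cis (- q * t)))) (at t within {a..b})"
      by (auto intro!: derivative_eq_intros)
    then show "((\<lambda>t. cis (- q * t)) has_vector_derivative - \<i> * complex_of_real q * cis (- q * t)) (at t within {a..b})"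
      unfolding has_vector_derivative_def by (simp add: scaleR_conv_of_real mult_ac)
  qed
  then have "integral {a..b} (\<lambda>t. - \<i> * complex_of_real q * cis (- q * t)) = cis (- q * b) - cis (- q * a)"
    by (rule integral_unique)
  then show ?thesis
    by (metis integral_mult_right)
qed

lemma sum_by_parts:
  fixes u g :: "nat \<Rightarrow> 'b::comm_ring"
  shows "(\<Sum>k<n. u k * (g (Suc k) - g k)) = u n * g n - u 0 * g 0 - (\<Sum>k<n. (u (Suc k) - u k) * g (Suc k))"
  by (induction n) (simp_all add: algebra_simps)

text \<open>Summation by parts moves the differences from the rough path to the smooth exponential.
  Uniform closeness of \<open>g j\<close> to a continuous \<open>h\<close> at the grid points is
  then enough, whatever the variation of \<open>h\<close>, and the limit is the integration-by-parts
  form used to define \<open>fourier_dH\<close>.\<close>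

lemma grid_stieltjes_sum_tendsto:
  fixes h :: "real \<Rightarrow> real" and g :: "nat \<Rightarrow> nat \<Rightarrow> real"
  assumes h: "continuous_on {-pi..pi} h" and \<nu>: "filterlim \<nu> at_top sequentially"
    and g: "\<And>j k. k \<le> \<nu> j \<Longrightarrow> \<bar>g j k - h (grid (\<nu> j) k)\<bar> \<le> \<delta> j" and \<delta>: "\<delta> \<longlonglongrightarrow> 0"
  shows "(\<lambda>j. \<Sum>k<\<nu> j. cis (- q * grid (\<nu> j) k) * complex_of_real (g j (Suc k) - g j k))
    \<longlonglongrightarrow> cis (- q * pi) * h pi - cis (q * pi) * h (-pi)
      + \<i> * complex_of_real q * integral {-pi..pi} (\<lambda>t. cis (- q * t) * complex_of_real (h t))"
    (is "?S \<longlonglongrightarrow> ?L")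
proof (rule tendstoI)
  fix e :: real assume e: "0 < e"
  \<comment> \<open>The two boundary terms cost \<open>d\<close> each and the integral term
    \<open>4 * pi * \<bar>q\<bar> * d\<close>; with this \<open>d\<close> they add up to
    \<open>e / 2\<close>.\<close>
  define d where "d = e / (4 + 8 * pi * \<bar>q\<bar>)"
  have den: "4 + 8 * pi * \<bar>q\<bar> > 0" by (simp add: add_pos_nonneg)
  then have d: "0 < d" using e by (simp add: d_def)
  have "\<forall>\<^sub>F j in sequentially. \<delta> j < d" using \<delta> d by (rule order_tendstoD)
  moreover have "\<forall>\<^sub>F j in sequentially. 0 < \<nu> j \<and> (\<forall>k<\<nu> j. \<forall>s\<in>{grid (\<nu> j) k..grid (\<nu> j) (Suc k)}.
    \<forall>t\<in>{grid (\<nu> j) k..grid (\<nu> j) (Suc k)}. dist (h s) (h t) \<le> d)"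
    using filterlim_iff[THEN iffD1, OF \<nu>, rule_format, OF eventually_grid_oscillation[OF h d]] by simp
  ultimately show "\<forall>\<^sub>F j in sequentially. dist (?S j) ?L < e"
  proof eventually_elim
    case (elim j)
    let ?n = "\<nu> j"
    let ?t = "grid ?n"
    have n: "0 < ?n" using elim by simp
    have "?S j = cis (- q * ?t ?n) * g j ?n - cis (- q * ?t 0) * g j 0
        - (\<Sum>k<?n. (cis (- q * ?t (Suc k)) - cis (- q * ?t k)) * g j (Suc k))"
      using sum_by_parts[of "\<lambda>k. cis (- q * ?t k)" "\<lambda>k. complex_of_real (g j k)" ?n] by simp
    also have "(\<Sum>k<?n. (cis (- q * ?t (Suc k)) - cis (- q * ?t k)) * g j (Suc k))
      = (\<Sum>k<?n. - \<i> * complex_of_real q * integral {?t k..?t (Suc k)} (\<lambda>t. cis (- q * t) * g j (Suc k)))"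
    proof (intro sum.cong refl)
      fix k
      have "cis (- q * ?t (Suc k)) - cis (- q * ?t k)
          = - \<i> * complex_of_real q * integral {?t k..?t (Suc k)} (\<lambda>t. cis (- q * t))"
        by (intro cis_diff_eq_integral grid_mono) simp
      then show "(cis (- q * ?t (Suc k)) - cis (- q * ?t k)) * g j (Suc k)
          = - \<i> * complex_of_real q * integral {?t k..?t (Suc k)} (\<lambda>t. cis (- q * t) * g j (Suc k))"
        by (simp only: integral_mult_left mult.assoc)
    qed
    also have "\<dots> = - \<i> * complex_of_real q * (\<Sum>k<?n. integral {?t k..?t (Suc k)} (\<lambda>t. cis (- q * t) * g j (Suc k)))"
      by (simp only: sum_distrib_left)
    finally have S: "?S j - ?L = cis (- q * pi) * (complex_of_real (g j ?n - h pi))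
        - cis (q * pi) * (complex_of_real (g j 0 - h (-pi)))
        - \<i> * complex_of_real q * (integral {-pi..pi} (\<lambda>t. cis (- q * t) * complex_of_real (h t))
          - (\<Sum>k<?n. integral {?t k..?t (Suc k)} (\<lambda>t. cis (- q * t) * g j (Suc k))))"
      using n by (simp add: algebra_simps)
    \<comment> \<open>One \<open>d\<close> pays for the oscillation of \<open>h\<close> within a
      cell, the other for the distance of \<open>g j\<close> from \<open>h\<close> at its right
      end.\<close>
    have "cmod (integral {-pi..pi} (\<lambda>t. cis (- q * t) * complex_of_real (h t))
          - (\<Sum>k<?n. integral {?t k..?t (Suc k)} (\<lambda>t. cis (- q * t) * g j (Suc k)))) \<le> 2 * pi * (2 * d)"
    proof (rule norm_integral_diff_sum_grid_le[OF _ n])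
      fix k t assume k: "k < ?n" and t: "t \<in> {?t k..?t (Suc k)}"
      have "\<bar>h t - h (?t (Suc k))\<bar> \<le> d"
        using elim k t by (auto simp: dist_real_def grid_mono)
      moreover have "\<bar>g j (Suc k) - h (?t (Suc k))\<bar> \<le> d"
        using g[of "Suc k" j] k elim(1) by simp
      ultimately have "\<bar>h t - g j (Suc k)\<bar> \<le> 2 * d" by linarith
      then show "cmod (cis (- q * t) * complex_of_real (h t) - cis (- q * t) * g j (Suc k)) \<le> 2 * d"
        by (simp add: norm_mult flip: right_diff_distrib of_real_diff)
    qed (auto intro!: continuous_intros h)
    then have "cmod (\<i> * complex_of_real q * (integral {-pi..pi} (\<lambda>t. cis (- q * t) * complex_of_real (h t))
          - (\<Sum>k<?n. integral {?t k..?t (Suc k)} (\<lambda>t. cis (- q * t) * g j (Suc k))))) \<le> \<bar>q\<bar> * (2 * pi * (2 * d))"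
      unfolding norm_mult by (simp add: mult_left_mono)
    moreover have "cmod (cis (- q * pi) * (complex_of_real (g j ?n - h pi))) \<le> d"
      using g[of ?n j] elim(1) n by (simp add: norm_mult del: of_real_diff)
    moreover have "cmod (cis (q * pi) * (complex_of_real (g j 0 - h (-pi)))) \<le> d"
      using g[of 0 j] elim(1) n by (simp add: norm_mult del: of_real_diff)
    moreover have tri: "cmod (a - b - c) \<le> cmod a + cmod b + cmod c" for a b c
      using norm_triangle_ineq4[of "a - b" c] norm_triangle_ineq4[of a b] by linarith
    ultimately have "cmod (?S j - ?L) \<le> d + d + \<bar>q\<bar> * (2 * pi * (2 * d))"
      unfolding S by (intro order_trans [OF tri] add_mono)
    also have "\<dots> = d * (4 + 8 * pi * \<bar>q\<bar>) / 2"
      by (simp add: algebra_simps)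
    also have "\<dots> = e / 2"
      using den unfolding d_def by simp
    also have "\<dots> < e" using e by simp
    finally show ?case by (simp only: dist_norm)
  qed
qed

text \<open>The Riemann sums approximate \<open>H - x\<close> rather than \<open>H\<close>. A
  constant has no increments: its boundary terms cancel against i q times the integral of the
  exponential.\<close>

lemma fourier_dH_shift:
  assumes "continuous_on {-pi..pi} (\<lambda>t. H t \<omega>)"
  shows "fourier_dH H q \<omega> = complex_of_real (1 / (2 * pi)) *
    (cis (- real_of_int q * pi) * complex_of_real (H pi \<omega> - x) - cis (real_of_int q * pi) * complex_of_real (H (-pi) \<omega> - x)
      + \<i> * complex_of_real (real_of_int q) *
        integral {-pi..pi} (\<lambda>t. cis (- real_of_int q * t) * complex_of_real (H t \<omega> - x)))"
proof -
  let ?q = "real_of_int q"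
  have "integral {-pi..pi} (\<lambda>t. cis (- ?q * t) * complex_of_real (H t \<omega> - x))
    = integral {-pi..pi} (\<lambda>t. cis (- ?q * t) * complex_of_real (H t \<omega>) - cis (- ?q * t) * complex_of_real x)"
    by (simp add: algebra_simps)
  also have "\<dots> = integral {-pi..pi} (\<lambda>t. cis (- ?q * t) * complex_of_real (H t \<omega>))
      - integral {-pi..pi} (\<lambda>t. cis (- ?q * t)) * complex_of_real x"
    by (subst integral_diff) (auto intro!: integrable_continuous_real continuous_intros assms)
  finally have *: "integral {-pi..pi} (\<lambda>t. cis (- ?q * t) * complex_of_real (H t \<omega> - x)) = \<dots>" .
  have "cis (- ?q * pi) - cis (- ?q * (- pi)) = - \<i> * complex_of_real ?q * integral {-pi..pi} (\<lambda>t. cis (- ?q * t))"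
    by (rule cis_diff_eq_integral) simp
  then have "\<i> * complex_of_real ?q * integral {-pi..pi} (\<lambda>t. cis (- ?q * t)) = cis (?q * pi) - cis (- ?q * pi)"
    by (simp add: algebra_simps)
  then have "\<i> * complex_of_real ?q * (integral {-pi..pi} (\<lambda>t. cis (- ?q * t)) * complex_of_real x)
      = (cis (?q * pi) - cis (- ?q * pi)) * complex_of_real x"
    by (simp only: mult.assoc [symmetric])
  then show ?thesis
    unfolding fourier_dH_def * right_diff_distrib [of "\<i> * complex_of_real ?q"]
    by (intro arg_cong2[of _ _ _ _ times] refl) (simp add: algebra_simps)
qed

section \<open>The discretised convolution\<close>

text \<open>Factoring out e^{-iq t_k} leaves the Dirichlet kernel of order \<open>N\<close> at t_k -
  t_j. The constant is the weight 2 pi / (2N + 1) of \<open>fourier_B\<close> times the two factors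
  1 / (2 pi) of \<open>fourier_dH\<close>.\<close>

definition conv_kernel :: "nat \<Rightarrow> int \<Rightarrow> nat \<Rightarrow> nat \<Rightarrow> nat \<Rightarrow> complex" where
  "conv_kernel N q n j k = complex_of_real (1 / (2 * pi * (2 * real N + 1))) *
     (\<Sum>l\<in>{- int N..int N}. cis (- real_of_int l * grid n j) * cis (- real_of_int (q - l) * grid n k))"

text \<open>The kernel is symmetrised onto j < k so that the coefficient of \<open>X k\<close>
  depends only on the past, as the supermartingale bounds require.\<close>

definition off_diagonal :: "nat \<Rightarrow> int \<Rightarrow> nat \<Rightarrow> (nat \<Rightarrow> real) \<Rightarrow> complex" where
  "off_diagonal N q n X =
     (\<Sum>k<n. \<Sum>j<k. (conv_kernel N q n j k + conv_kernel N q n k j) * complex_of_real (X j * X k))"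

text \<open>With \<open>w\<close> the Brownian increments, this is the weighted realised variance
  minus the Riemann sum of e^{-iqt} a^2.\<close>

definition diagonal_error :: "int \<Rightarrow> nat \<Rightarrow> (nat \<Rightarrow> real) \<Rightarrow> (nat \<Rightarrow> real) \<Rightarrow> complex" where
  "diagonal_error q n a w = (\<Sum>k<n. cis (- real_of_int q * grid n k) *
     complex_of_real ((a k)\<^sup>2 * ((w k)\<^sup>2 - 2 * pi / n)))"

text \<open>For equal times the dependence on \<open>l\<close> cancels, so \<open>2 * N + 1\<close>
  equal terms compensate the normalisation and \<open>N\<close> disappears.\<close>

lemma conv_kernel_diagonal:
  "conv_kernel N q n k k = complex_of_real (1 / (2 * pi)) * cis (- real_of_int q * grid n k)"
proof -
  have "(\<Sum>l\<in>{- int N..int N}. cis (- real_of_int l * grid n k) * cis (- real_of_int (q - l) * grid n k))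
    = (\<Sum>l\<in>{- int N..int N}. cis (- real_of_int q * grid n k))"
    by (intro sum.cong refl) (simp add: cis_mult algebra_simps)
  also have "\<dots> = complex_of_real (2 * real N + 1) * cis (- real_of_int q * grid n k)"
    by (simp add: nat_add_distrib)
  finally have "conv_kernel N q n k k = complex_of_real (1 / (2 * pi * (2 * real N + 1))) *
      complex_of_real (2 * real N + 1) * cis (- real_of_int q * grid n k)"
    unfolding conv_kernel_def by (simp only: mult.assoc)
  moreover have "2 * real N + 1 \<noteq> 0" by linarith
  ultimately show ?thesis
    unfolding of_real_mult [symmetric] by simp
qed

text \<open>The frequency \<open>q\<close> enters only through a phase, so all later bounds are
  uniform in \<open>q\<close>.\<close>

lemma cmod_conv_kernel:
  "cmod (conv_kernel N q n j k) = 1 / (2 * pi * (2 * real N + 1)) *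
    cmod (\<Sum>l\<in>{- int N..int N}. cis (real_of_int l * grid n k) * cis (- real_of_int l * grid n j))"
proof -
  have "(\<Sum>l\<in>{- int N..int N}. cis (- real_of_int l * grid n j) * cis (- real_of_int (q - l) * grid n k))
    = cis (- real_of_int q * grid n k) *
      (\<Sum>l\<in>{- int N..int N}. cis (real_of_int l * grid n k) * cis (- real_of_int l * grid n j))"
    unfolding sum_distrib_left by (intro sum.cong refl) (simp add: cis_mult algebra_simps)
  then have "cmod (conv_kernel N q n j k) = \<bar>1 / (2 * pi * (2 * real N + 1))\<bar> *
    cmod (\<Sum>l\<in>{- int N..int N}. cis (real_of_int l * grid n k) * cis (- real_of_int l * grid n j))"
    unfolding conv_kernel_def by (simp only: norm_mult norm_of_real norm_cis mult_1)
  then show ?thesis by simp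
qed

lemma cmod_conv_kernel_swap: "cmod (conv_kernel N q n k j) = cmod (conv_kernel N q n j k)"
proof -
  have "(\<Sum>l\<in>{- int N..int N}. cis (real_of_int l * grid n j) * cis (- real_of_int l * grid n k))
    = cnj (\<Sum>l\<in>{- int N..int N}. cis (real_of_int l * grid n k) * cis (- real_of_int l * grid n j))"
    by (simp add: cis_cnj mult.commute)
  then show ?thesis
    unfolding cmod_conv_kernel by (simp only: complex_mod_cnj)
qed

text \<open>Parseval with the \<open>2 * N + 1\<close> unimodular weights e^{il t_k}. Multiplied by
  the step 2 pi / n this gives the order 1 / N of the variance.\<close>

lemma sum_norm_conv_kernel:
  assumes "2 * N < n"
  shows "(\<Sum>j<n. (cmod (conv_kernel N q n j k))\<^sup>2) = n / (4 * pi\<^sup>2 * (2 * real N + 1))"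
proof -
  have "(\<Sum>j<n. (cmod (conv_kernel N q n j k))\<^sup>2) = (1 / (2 * pi * (2 * real N + 1)))\<^sup>2 *
    (\<Sum>j<n. (cmod (\<Sum>l\<in>{- int N..int N}. cis (real_of_int l * grid n k) * cis (- real_of_int l * grid n j)))\<^sup>2)"
    unfolding cmod_conv_kernel power_mult_distrib by (simp only: sum_distrib_left)
  also have "\<dots> = (1 / (2 * pi * (2 * real N + 1)))\<^sup>2 * (n * (2 * real N + 1))"
    unfolding sum_norm_trig_poly_grid[OF assms] by (simp add: nat_add_distrib)
  also have "\<dots> = n / (4 * pi\<^sup>2 * (2 * real N + 1))"
  proof -
    have "2 * real N + 1 \<noteq> 0" by linarith
    then show ?thesis by (simp add: power2_eq_square)
  qed
  finally show ?thesis .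
qed

lemma sum_square_split:
  fixes f :: "nat \<Rightarrow> nat \<Rightarrow> 'b::comm_monoid_add"
  shows "(\<Sum>k<n. \<Sum>j<n. f j k) = (\<Sum>k<n. \<Sum>j<k. f j k + f k j) + (\<Sum>k<n. f k k)"
  by (induction n) (simp_all add: sum.distrib ac_simps)

text \<open>\<open>D l\<close> is the grid version of \<open>fourier_dH\<close>. Expanding the
  product \<open>D l * D (q - l)\<close> and summing over \<open>l\<close> gives the full double sum
  with \<open>conv_kernel\<close>; removing the terms j = k leaves the claim.\<close>

lemma off_diagonal_eq:
  fixes X :: "nat \<Rightarrow> real" and n :: nat
  defines "D \<equiv> \<lambda>l :: int. complex_of_real (1 / (2 * pi)) * (\<Sum>k<n. cis (- real_of_int l * grid n k) * complex_of_real (X k))"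
  shows "off_diagonal N q n X = complex_of_real (2 * pi / (2 * real N + 1)) * (\<Sum>l\<in>{- int N..int N}. D l * D (q - l))
    - complex_of_real (1 / (2 * pi)) * (\<Sum>k<n. cis (- real_of_int q * grid n k) * complex_of_real ((X k)\<^sup>2))"
proof -
  let ?L = "{- int N..int N}" and ?K = "conv_kernel N q n"
  define Q where "Q = (\<lambda>j k. \<Sum>l\<in>?L. cis (- real_of_int l * grid n j) * cis (- real_of_int (q - l) * grid n k))"
  have K: "?K j k = complex_of_real (1 / (2 * pi * (2 * real N + 1))) * Q j k" for j k
    unfolding conv_kernel_def Q_def ..
  have "D l * D (q - l) = complex_of_real (1 / (4 * pi\<^sup>2)) *
      (\<Sum>k<n. \<Sum>j<n. (cis (- real_of_int l * grid n j) * cis (- real_of_int (q - l) * grid n k)) * complex_of_real (X j * X k))" for l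
  proof -
    have "D l * D (q - l) = complex_of_real (1 / (4 * pi\<^sup>2)) *
      ((\<Sum>j<n. cis (- real_of_int l * grid n j) * complex_of_real (X j)) *
       (\<Sum>k<n. cis (- real_of_int (q - l) * grid n k) * complex_of_real (X k)))"
      unfolding D_def by (simp add: power2_eq_square)
    also have "\<dots> = complex_of_real (1 / (4 * pi\<^sup>2)) *
      (\<Sum>j<n. \<Sum>k<n. (cis (- real_of_int l * grid n j) * cis (- real_of_int (q - l) * grid n k)) * complex_of_real (X j * X k))"
      by (simp add: sum_product mult_ac)
    finally show ?thesis by (subst sum.swap)
  qed
  then have D: "D l * D (q - l) = (\<Sum>k<n. \<Sum>j<n. complex_of_real (1 / (4 * pi\<^sup>2)) *
      ((cis (- real_of_int l * grid n j) * cis (- real_of_int (q - l) * grid n k)) * complex_of_real (X j * X k)))" for l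
    unfolding sum_distrib_left .
  have "(\<Sum>l\<in>?L. D l * D (q - l)) = complex_of_real (1 / (4 * pi\<^sup>2)) *
      (\<Sum>k<n. \<Sum>j<n. (\<Sum>l\<in>?L. cis (- real_of_int l * grid n j) * cis (- real_of_int (q - l) * grid n k)) * complex_of_real (X j * X k))"
    unfolding sum_distrib_right sum_distrib_left D
    by (subst sum.swap, intro sum.cong refl, rule sum.swap)
  moreover have "complex_of_real (2 * pi / (2 * real N + 1)) * complex_of_real (1 / (4 * pi\<^sup>2))
      = complex_of_real (1 / (2 * pi * (2 * real N + 1)))"
    unfolding of_real_mult [symmetric] by (simp add: power2_eq_square)
  ultimately have "complex_of_real (2 * pi / (2 * real N + 1)) * (\<Sum>l\<in>?L. D l * D (q - l))
    = complex_of_real (1 / (2 * pi * (2 * real N + 1))) * (\<Sum>k<n. \<Sum>j<n. Q j k * complex_of_real (X j * X k))"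
    unfolding Q_def by (simp only: mult.assoc [symmetric])
  also have "\<dots> = (\<Sum>k<n. \<Sum>j<n. ?K j k * complex_of_real (X j * X k))"
    unfolding K sum_distrib_left by (simp only: mult.assoc)
  also have "\<dots> = off_diagonal N q n X + (\<Sum>k<n. ?K k k * complex_of_real (X k * X k))"
    unfolding sum_square_split off_diagonal_def by (simp add: algebra_simps)
  also have "(\<Sum>k<n. ?K k k * complex_of_real (X k * X k))
    = complex_of_real (1 / (2 * pi)) * (\<Sum>k<n. cis (- real_of_int q * grid n k) * complex_of_real ((X k)\<^sup>2))"
    unfolding conv_kernel_diagonal by (simp only: sum_distrib_left power2_eq_square mult.assoc)
  finally show ?thesis by simp
qed

text \<open>Since \<bar>Re z\<bar> + \<bar>Im z\<bar> bounds the modulus, one of the four axis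
  directions captures at least half of it; this reduces complex forms to real ones.\<close>

lemma exp_cmod_le:
  assumes "0 \<le> l"
  shows "exp (l * cmod z / 2) \<le> (\<Sum>u\<in>{1, -1, \<i>, -\<i>}. exp (l * Re (u * z)))"
proof -
  have "cmod z \<le> \<bar>Re z\<bar> + \<bar>Im z\<bar>" by (rule cmod_le)
  then have "\<exists>u\<in>{1, -1, \<i>, -\<i>}. cmod z / 2 \<le> Re (u * z)"
    by (auto simp: abs_if split: if_splits)
  then obtain u where u: "u \<in> {1, -1, \<i>, -\<i>}" "cmod z / 2 \<le> Re (u * z)" by blast
  have "l * (cmod z / 2) \<le> l * Re (u * z)" using u(2) assms by (rule mult_left_mono)
  then have "exp (l * cmod z / 2) \<le> exp (l * Re (u * z))" by simp
  also have "\<dots> \<le> (\<Sum>u\<in>{1, -1, \<i>, -\<i>}. exp (l * Re (u * z)))"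
    using u(1) by (intro member_le_sum) auto
  finally show ?thesis .
qed

lemma nn_integral_exp_cmod_le:
  assumes Z [measurable]: "Z \<in> borel_measurable M" and l: "0 \<le> l" and C: "0 \<le> C"
    and le: "\<And>u. cmod u = 1 \<Longrightarrow> (\<integral>\<^sup>+\<omega>. ennreal (exp (l * Re (u * Z \<omega>))) \<partial>M) \<le> ennreal C"
  shows "(\<integral>\<^sup>+\<omega>. ennreal (exp (l * cmod (Z \<omega>) / 2)) \<partial>M) \<le> ennreal (4 * C)"
proof -
  let ?U = "{1, -1, \<i>, -\<i>}"
  have "(\<integral>\<^sup>+\<omega>. ennreal (exp (l * cmod (Z \<omega>) / 2)) \<partial>M)
      \<le> (\<integral>\<^sup>+\<omega>. (\<Sum>u\<in>?U. ennreal (exp (l * Re (u * Z \<omega>)))) \<partial>M)"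
  proof (intro nn_integral_mono)
    fix \<omega>
    have "ennreal (exp (l * cmod (Z \<omega>) / 2)) \<le> ennreal (\<Sum>u\<in>?U. exp (l * Re (u * Z \<omega>)))"
      by (rule ennreal_leI[OF exp_cmod_le[OF l]])
    also have "\<dots> = (\<Sum>u\<in>?U. ennreal (exp (l * Re (u * Z \<omega>))))"
      by (rule sum_ennreal [symmetric]) simp
    finally show "ennreal (exp (l * cmod (Z \<omega>) / 2)) \<le> (\<Sum>u\<in>?U. ennreal (exp (l * Re (u * Z \<omega>))))" .
  qed
  also have "\<dots> = (\<Sum>u\<in>?U. \<integral>\<^sup>+\<omega>. ennreal (exp (l * Re (u * Z \<omega>))) \<partial>M)"
    by (rule nn_integral_sum) measurable
  also have "\<dots> \<le> (\<Sum>u\<in>?U. ennreal C)"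
    by (intro sum_mono le) auto
  also have "\<dots> = ennreal (\<Sum>u\<in>?U. C)"
    using C by (intro sum_ennreal)
  also have "(\<Sum>u\<in>?U. C) = 4 * C"
    by (simp add: complex_eq_iff)
  finally show ?thesis .
qed

text \<open>The total time \<open>n * (2 * pi / n)\<close> is the same for every \<open>n\<close>,
  which keeps the quadratic form bound uniform in the mesh.\<close>

locale gaussian_grid = gaussian_increments M G \<xi> n "2 * pi / n"
  for M :: "'a measure" and G \<xi> n +
  fixes a :: "nat \<Rightarrow> 'a \<Rightarrow> real" and m :: real
  assumes n_pos: "0 < n" and m_pos: "0 < m"
    and a_meas: "k < n \<Longrightarrow> a k \<in> borel_measurable (G k)"
    and a_bound: "k < n \<Longrightarrow> \<omega> \<in> space M \<Longrightarrow> \<bar>a k \<omega>\<bar> \<le> m"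
begin

lemma a_xi_measurable:
  assumes "k < n"
  shows "a k \<in> borel_measurable M" "\<xi> k \<in> borel_measurable M"
  using assms measurable_G[OF a_meas] measurable_G[OF adapted] by auto

lemma off_diagonal_measurable [measurable]:
  "(\<lambda>\<omega>. off_diagonal N q n (\<lambda>k. a k \<omega> * \<xi> k \<omega>)) \<in> borel_measurable M"
proof -
  have meas: "(\<lambda>\<omega>. complex_of_real ((a j \<omega> * \<xi> j \<omega>) * (a k \<omega> * \<xi> k \<omega>))) \<in> borel_measurable M"
    if "k < n" "j < k" for j k
    using a_xi_measurable[of k] a_xi_measurable[of j] that by simp
  show ?thesis
    unfolding off_diagonal_def
    by (intro borel_measurable_sum borel_measurable_times[OF borel_measurable_const] meas) auto
qed

text \<open>With V = 2 / (pi (2N + 1)) and total time 2 pi, the condition of the quadratic form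
  bound reads 16 l^2 m^4 / (2N + 1) \<le> 3/4; the chosen \<open>l\<close> makes the left side 1/4.
  The 12 is 3 for each of four directions.\<close>

lemma nn_integral_exp_off_diagonal_le:
  assumes N: "2 * N < n"
  shows "(\<integral>\<^sup>+\<omega>. ennreal (exp (sqrt (2 * real N + 1) / (8 * m\<^sup>2) *
      cmod (off_diagonal N q n (\<lambda>k. a k \<omega> * \<xi> k \<omega>)) / 2)) \<partial>M) \<le> ennreal 12"
proof -
  define l where "l = sqrt (2 * real N + 1) / (8 * m\<^sup>2)"
  let ?K = "conv_kernel N q n"
  have "(\<integral>\<^sup>+\<omega>. ennreal (exp (l * Re (u * off_diagonal N q n (\<lambda>k. a k \<omega> * \<xi> k \<omega>)))) \<partial>M) \<le> ennreal 3"
    if u: "cmod u = 1" for u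
  proof -
    define c where "c = (\<lambda>j k. Re (u * (?K j k + ?K k j)))"
    have "(\<integral>\<^sup>+\<omega>. ennreal (exp (l * (\<Sum>k<n. \<Sum>j<k. c j k * (a j \<omega> * \<xi> j \<omega>) * (a k \<omega> * \<xi> k \<omega>)))) \<partial>M) \<le> 3"
    proof (rule nn_integral_exp_quadratic_form_le[OF n_pos a_meas a_bound])
      fix k assume k: "k < n"
      have "(\<Sum>j<k. (c j k)\<^sup>2) \<le> (\<Sum>j<n. 4 * (cmod (?K j k))\<^sup>2)"
      proof -
        have "(c j k)\<^sup>2 \<le> 4 * (cmod (?K j k))\<^sup>2" for j
        proof -
          have "\<bar>c j k\<bar> \<le> cmod (?K j k + ?K k j)"
            unfolding c_def using abs_Re_le_cmod[of "u * (?K j k + ?K k j)"] u by (simp add: norm_mult)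
          also have "\<dots> \<le> 2 * cmod (?K j k)"
            using norm_triangle_ineq[of "?K j k" "?K k j"] by (simp add: cmod_conv_kernel_swap[of N q n k j])
          finally have "\<bar>c j k\<bar>\<^sup>2 \<le> (2 * cmod (?K j k))\<^sup>2" by (rule power_mono) simp
          then show ?thesis by (simp add: power_mult_distrib)
        qed
        then have "(\<Sum>j<k. (c j k)\<^sup>2) \<le> (\<Sum>j<k. 4 * (cmod (?K j k))\<^sup>2)"
          by (rule sum_mono)
        also have "\<dots> \<le> (\<Sum>j<n. 4 * (cmod (?K j k))\<^sup>2)"
          using k by (intro sum_mono2) auto
        finally show ?thesis .
      qed
      also have "\<dots> = 4 * (n / (4 * pi\<^sup>2 * (2 * real N + 1)))"
        using sum_norm_conv_kernel[OF N, of q k] by (simp only: sum_distrib_left [symmetric])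
      finally have "(\<Sum>j<k. (c j k)\<^sup>2) * (2 * pi / n) \<le> 4 * (n / (4 * pi\<^sup>2 * (2 * real N + 1))) * (2 * pi / n)"
        by (rule mult_right_mono) simp
      also have "\<dots> = 2 / (pi * (2 * real N + 1))"
        using n_pos by (simp add: power2_eq_square)
      finally show "(\<Sum>j<k. (c j k)\<^sup>2) * (2 * pi / n) \<le> 2 / (pi * (2 * real N + 1))" .
    next
      have *: "2 * real N + 1 \<noteq> 0" by linarith
      have "l\<^sup>2 = (2 * real N + 1) / (64 * m ^ 4)"
        by (simp add: l_def power_divide power_mult_distrib power2_eq_square power4_eq_xxxx)
      then have "4 * l\<^sup>2 * m ^ 4 * (n * (2 * pi / n)) * (2 / (pi * (2 * real N + 1))) = 1 / 4"
        using * m_pos n_pos by simp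
      then show "4 * l\<^sup>2 * m ^ 4 * (n * (2 * pi / n)) * (2 / (pi * (2 * real N + 1))) \<le> 3 / 4"
        by simp
    qed auto
    moreover have "Re (u * off_diagonal N q n (\<lambda>k. a k \<omega> * \<xi> k \<omega>))
        = (\<Sum>k<n. \<Sum>j<k. c j k * (a j \<omega> * \<xi> j \<omega>) * (a k \<omega> * \<xi> k \<omega>))" for \<omega>
    proof -
      have "Re (u * (z * complex_of_real (x * y))) = Re (u * z) * x * y" for z x y
        by (simp add: algebra_simps)
      then show ?thesis
        unfolding off_diagonal_def c_def sum_distrib_left by (simp only: Re_sum)
    qed
    ultimately show ?thesis by simp
  qed
  from nn_integral_exp_cmod_le[OF off_diagonal_measurable _ _ this] show ?thesis
    using m_pos by (simp add: l_def)
qed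

lemma diagonal_error_measurable [measurable]: "(\<lambda>\<omega>. diagonal_error q n (\<lambda>k. a k \<omega>) (\<lambda>k. \<xi> k \<omega>)) \<in> borel_measurable M"
proof -
  have meas: "(\<lambda>\<omega>. complex_of_real ((a k \<omega>)\<^sup>2 * ((\<xi> k \<omega>)\<^sup>2 - 2 * pi / n))) \<in> borel_measurable M"
    if "k < n" for k
    using a_xi_measurable[OF that] by measurable
  show ?thesis
    unfolding diagonal_error_def
    by (intro borel_measurable_sum borel_measurable_times[OF borel_measurable_const] meas) auto
qed

text \<open>A sum of \<open>n\<close> centred squares, each of size 1 / n, fluctuates at order
  n^{-1/2}. At scale sqrt n the bound is B = l m^2, with B \<Delta> = 1 / (4 sqrt n) and total
  compensator 1/4.\<close>

lemma nn_integral_exp_diagonal_error_le: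
  "(\<integral>\<^sup>+\<omega>. ennreal (exp (sqrt n / (8 * pi * m\<^sup>2) * cmod (diagonal_error q n (\<lambda>k. a k \<omega>) (\<lambda>k. \<xi> k \<omega>)) / 2)) \<partial>M)
    \<le> ennreal (4 * exp (1 / 4))"
proof -
  define l where "l = sqrt n / (8 * pi * m\<^sup>2)"
  have l: "0 \<le> l" by (simp add: l_def)
  have "(\<integral>\<^sup>+\<omega>. ennreal (exp (l * Re (u * diagonal_error q n (\<lambda>k. a k \<omega>) (\<lambda>k. \<xi> k \<omega>)))) \<partial>M) \<le> ennreal (exp (1 / 4))"
    if u: "cmod u = 1" for u
  proof -
    define b where "b = (\<lambda>k \<omega>. l * Re (u * cis (- real_of_int q * grid n k)) * (a k \<omega>)\<^sup>2)"
    have "(\<integral>\<^sup>+\<omega>. ennreal (exp (\<Sum>k<n. b k \<omega> * ((\<xi> k \<omega>)\<^sup>2 - 2 * pi / n))) \<partial>M)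
      \<le> ennreal (exp (4 * n * (l * m\<^sup>2)\<^sup>2 * (2 * pi / n)\<^sup>2))"
    proof (rule nn_integral_exp_centred_squares_le)
      fix k assume k: "k < n"
      show "b k \<in> borel_measurable (G k)"
        unfolding b_def using a_meas[OF k] by measurable
      fix \<omega> assume "\<omega> \<in> space M"
      then have "(a k \<omega>)\<^sup>2 \<le> m\<^sup>2"
        using a_bound[OF k] m_pos by (simp add: abs_le_square_iff [symmetric])
      moreover have "\<bar>Re (u * cis (- real_of_int q * grid n k))\<bar> \<le> 1"
        using abs_Re_le_cmod[of "u * cis (- real_of_int q * grid n k)"] u by (simp add: norm_mult)
      ultimately have "\<bar>Re (u * cis (- real_of_int q * grid n k))\<bar> * (a k \<omega>)\<^sup>2 \<le> 1 * m\<^sup>2"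
        by (intro mult_mono) auto
      then have "l * (\<bar>Re (u * cis (- real_of_int q * grid n k))\<bar> * (a k \<omega>)\<^sup>2) \<le> l * m\<^sup>2"
        using l by (intro mult_left_mono) auto
      then show "\<bar>b k \<omega>\<bar> \<le> l * m\<^sup>2"
        unfolding b_def using l by (simp only: abs_mult abs_of_nonneg power2_abs abs_power2 mult.assoc)
    next
      have "sqrt n \<le> n"
        using n_pos by (intro real_le_lsqrt) (auto simp: self_le_power)
      then have "sqrt n * (2 * pi) / (8 * pi * n) \<le> 1 / 4"
        using n_pos by (simp add: divide_le_eq)
      then show "l * m\<^sup>2 * (2 * pi / n) \<le> 1 / 4"
        using m_pos by (simp add: l_def)
    qed
    also have "4 * n * (l * m\<^sup>2)\<^sup>2 * (2 * pi / n)\<^sup>2 = 1 / 4"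
      using n_pos m_pos by (simp add: l_def power_divide power_mult_distrib) (simp add: power2_eq_square)
    finally have le: "(\<integral>\<^sup>+\<omega>. ennreal (exp (\<Sum>k<n. b k \<omega> * ((\<xi> k \<omega>)\<^sup>2 - 2 * pi / n))) \<partial>M)
      \<le> ennreal (exp (1 / 4))" .
    have "(\<Sum>k<n. b k \<omega> * ((\<xi> k \<omega>)\<^sup>2 - 2 * pi / n))
        = l * Re (u * diagonal_error q n (\<lambda>k. a k \<omega>) (\<lambda>k. \<xi> k \<omega>))" for \<omega>
    proof -
      have "l * Re (u * (z * complex_of_real (x * y))) = l * Re (u * z) * x * y" for z x y
        by (simp add: algebra_simps)
      then show ?thesis
        unfolding diagonal_error_def b_def by (simp only: sum_distrib_left Re_sum)
    qed
    then show ?thesis using le by simp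
  qed
  from nn_integral_exp_cmod_le[OF diagonal_error_measurable l _ this] show ?thesis
    by (simp add: l_def)
qed

end

section \<open>Almost sure statements from moment bounds\<close>

lemma (in prob_space) AE_eventually_less_1:
  fixes f :: "nat \<Rightarrow> 'a \<Rightarrow> ennreal"
  assumes f [measurable]: "\<And>n. f n \<in> borel_measurable M"
    and le: "\<And>n. (\<integral>\<^sup>+\<omega>. f n \<omega> \<partial>M) \<le> ennreal (c n)" and c: "\<And>n. 0 \<le> c n" "summable c"
  shows "AE \<omega> in M. \<forall>\<^sub>F n in sequentially. f n \<omega> < 1"
proof -
  define A where "A = (\<lambda>n. {\<omega> \<in> space M. 1 \<le> f n \<omega>})"
  have [measurable]: "A n \<in> sets M" for n unfolding A_def by measurable
  have "prob (A n) \<le> c n" for n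
  proof -
    have "emeasure M (A n) \<le> (\<integral>\<^sup>+\<omega>. f n \<omega> * indicator (space M) \<omega> \<partial>M)"
      using nn_integral_Markov_inequality[of "f n" "space M" M 1] f unfolding A_def by simp
    also have "\<dots> = (\<integral>\<^sup>+\<omega>. f n \<omega> \<partial>M)" by (intro nn_integral_cong) simp
    finally have "ennreal (prob (A n)) \<le> ennreal (c n)"
      using le[of n] by (simp add: emeasure_eq_measure order_trans)
    then show ?thesis using c(1) by (simp add: ennreal_le_iff)
  qed
  then have "summable (\<lambda>n. prob (A n))"
    by (intro summable_comparison_test'[OF c(2)]) auto
  then have "AE \<omega> in M. \<forall>\<^sub>F n in sequentially. \<omega> \<in> space M - A n"
    by (intro borel_cantelli_AE1) (auto simp: emeasure_eq_measure less_top)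
  then show ?thesis
    by eventually_elim (auto simp: A_def not_le elim!: eventually_mono)
qed

lemma (in prob_space) AE_tendsto_0_of_exp_moments:
  fixes Z :: "nat \<Rightarrow> 'a \<Rightarrow> real"
  assumes Z [measurable]: "\<And>n. 0 < n \<Longrightarrow> Z n \<in> borel_measurable M" and nonneg: "\<And>n \<omega>. 0 \<le> Z n \<omega>"
    and le: "\<And>n. 0 < n \<Longrightarrow> (\<integral>\<^sup>+\<omega>. ennreal (exp (sqrt n * \<kappa> * Z n \<omega>)) \<partial>M) \<le> ennreal C"
    and \<kappa>: "0 < \<kappa>" and C: "0 \<le> C"
  shows "AE \<omega> in M. (\<lambda>n. Z n \<omega>) \<longlonglongrightarrow> 0"
proof -
  \<comment> \<open>The weight n^{-2} makes the integrals summable, and f_n < 1 then forces the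
    exponential below n^2, that is Z_n < 2 ln n / (sqrt n \<kappa>). At n = 0 the value 0 avoids the
    degenerate grid.\<close>
  define f where "f = (\<lambda>n \<omega>. if n = 0 then 0 else ennreal (1 / real n ^ 2) * ennreal (exp (sqrt n * \<kappa> * Z n \<omega>)))"
  have "AE \<omega> in M. \<forall>\<^sub>F n in sequentially. f n \<omega> < 1"
  proof (rule AE_eventually_less_1)
    fix n
    show "f n \<in> borel_measurable M"
      unfolding f_def by (cases "n = 0") auto
    show "(\<integral>\<^sup>+\<omega>. f n \<omega> \<partial>M) \<le> ennreal (1 / real n ^ 2 * C)"
    proof (cases "n = 0")
      case False
      then have "(\<integral>\<^sup>+\<omega>. f n \<omega> \<partial>M) = ennreal (1 / real n ^ 2) * (\<integral>\<^sup>+\<omega>. ennreal (exp (sqrt n * \<kappa> * Z n \<omega>)) \<partial>M)"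
        by (simp add: f_def nn_integral_cmult)
      also have "\<dots> \<le> ennreal (1 / real n ^ 2) * ennreal C"
        using le[of n] False by (intro mult_left_mono) auto
      finally show ?thesis using C by (simp only: ennreal_mult [symmetric] zero_le_divide_1_iff zero_le_power of_nat_0_le_iff)
    qed (simp add: f_def)
    show "0 \<le> 1 / real n ^ 2 * C" using C by simp
  next
    have "summable (\<lambda>n. inverse (real n ^ 2))" by (rule inverse_power_summable) simp
    then show "summable (\<lambda>n. 1 / real n ^ 2 * C)"
      by (intro summable_mult2) (simp add: inverse_eq_divide)
  qed
  then show ?thesis
  proof eventually_elim
    case (elim \<omega>)
    have "\<forall>\<^sub>F n in sequentially. Z n \<omega> \<le> 2 * ln n / (sqrt n * \<kappa>)"
      using elim eventually_gt_at_top[of 0]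
    proof eventually_elim
      case (elim n)
      then have "ennreal (1 / real n ^ 2 * exp (sqrt n * \<kappa> * Z n \<omega>)) < ennreal 1"
        by (simp add: f_def ennreal_mult [symmetric])
      then have "1 / real n ^ 2 * exp (sqrt n * \<kappa> * Z n \<omega>) < 1"
        by (subst (asm) ennreal_less_iff) auto
      then have "exp (sqrt n * \<kappa> * Z n \<omega>) < real n ^ 2"
        using elim by (simp add: divide_less_eq)
      then have "sqrt n * \<kappa> * Z n \<omega> < ln (real n ^ 2)"
        using elim by (metis exp_gt_zero ln_exp ln_less_cancel_iff order_less_trans)
      then show ?case
        using elim \<kappa> by (simp add: ln_realpow pos_le_divide_eq mult_ac)
    qed
    moreover have "(\<lambda>n. 2 * ln n / (sqrt n * \<kappa>)) \<longlonglongrightarrow> 0"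
      using \<kappa> by real_asymp
    ultimately show ?case
      by (rule tendsto_sandwich[OF always_eventually[OF allI[OF nonneg]] _ tendsto_const])
  qed
qed

section \<open>Sampling the processes on the grid\<close>

definition clip :: "real \<Rightarrow> real \<Rightarrow> real" where
  "clip m y = max (- m) (min m y)"

lemma abs_clip_le: "0 \<le> m \<Longrightarrow> \<bar>clip m y\<bar> \<le> m"
  by (auto simp: clip_def)

lemma clip_id: "\<bar>y\<bar> \<le> m \<Longrightarrow> clip m y = y"
  by (auto simp: clip_def)

lemma clip_measurable [measurable]: "clip m \<in> borel_measurable borel"
  unfolding clip_def by measurable

lemma progressive_adapted:
  assumes "progressive F X" "t \<in> {-pi..pi}"
  shows "X t \<in> borel_measurable (F t)"
proof -
  have X: "(\<lambda>(s, \<omega>). X s \<omega>) \<in> (restrict_space borel {-pi..t} \<Otimes>\<^sub>M F t) \<rightarrow>\<^sub>M borel"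
    using assms by (simp add: progressive_def)
  have "Pair t \<in> F t \<rightarrow>\<^sub>M restrict_space borel {-pi..t} \<Otimes>\<^sub>M F t"
    using assms(2) by (intro measurable_Pair1') (simp add: space_restrict_space)
  from measurable_compose[OF this X] show ?thesis by simp
qed

definition grid_incr :: "(real \<Rightarrow> 'a \<Rightarrow> real) \<Rightarrow> nat \<Rightarrow> nat \<Rightarrow> 'a \<Rightarrow> real" where
  "grid_incr W n k \<omega> = W (grid n (Suc k)) \<omega> - W (grid n k) \<omega>"

text \<open>The coefficient sits at the left end of each cell, as in \<open>riemann_sum\<close>, and
  is therefore known before the increment it multiplies.\<close>

lemma gaussian_grid_brownian:
  assumes sp: "usual_filtered_space M F" and BM: "brownian_motion M F W" and pr: "progressive F \<sigma>"
    and n: "0 < n" and m: "0 < m"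
  shows "gaussian_grid M (\<lambda>k. F (grid n k)) (grid_incr W n) n (\<lambda>k \<omega>. clip m (\<sigma> (grid n k) \<omega>)) m"
proof -
  interpret prob_space M using sp by (simp add: usual_filtered_space_def)
  have fil: "filtration (space M) F" using sp by (simp add: usual_filtered_space_def)
  have sub: "subalgebra M (F t)" for t
    using sp filtration.space_F[OF fil] by (auto simp: usual_filtered_space_def subalgebra_def)
  have sub_mono: "subalgebra (F t) (F s)" if "s \<le> t" for s t
    using filtration.space_F[OF fil] filtration.sets_F_mono[OF fil that] by (auto simp: subalgebra_def)
  have W: "W (grid n k) \<in> borel_measurable (F (grid n k))" if "k \<le> n" for k
    using BM grid_mem[OF that n] by (simp add: brownian_motion_def)
  have lt: "grid n k < grid n (Suc k)" for k
    using grid_Suc_diff[of n k] n by (metis diff_gt_0_iff_gt divide_pos_pos mult_pos_pos of_nat_0_less_iff pi_gt_zero zero_less_numeral)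
  have inc: "distributed M lborel (grid_incr W n k) (\<lambda>y. ennreal (normal_density 0 (sqrt (2 * pi / n)) y))
      \<and> indep_set (sets (F (grid n k))) {grid_incr W n k -` A \<inter> space M | A. A \<in> sets borel}" if "k < n" for k
    using BM grid_mem[of k n] grid_mem[of "Suc k" n] that n lt[of k]
    unfolding brownian_motion_def grid_incr_def grid_Suc_diff [symmetric, of n k] by auto
  show ?thesis
  proof (unfold_locales, goal_cases)
    case 1 show ?case using n by simp
  next
    case (2 k) show ?case by (rule sub)
  next
    case (3 j k) then show ?case
      using filtration.sets_F_mono[OF fil grid_mono] by simp
  next
    case (4 k)
    then have "W (grid n k) \<in> borel_measurable (F (grid n (Suc k)))"
      using measurable_from_subalg[OF sub_mono[OF grid_mono] W] by simp
    then show ?case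
      using W[of "Suc k"] 4 unfolding grid_incr_def by simp
  next
    case (5 k) then show ?case using inc by simp
  next
    case (6 k) then show ?case using inc by simp
  next
    case 7 show ?case by (rule n)
  next
    case 8 show ?case by (rule m)
  next
    case (9 k)
    then have [measurable]: "\<sigma> (grid n k) \<in> borel_measurable (F (grid n k))"
      using progressive_adapted[OF pr grid_mem] n by simp
    show ?case by measurable
  next
    case 10 show ?case using m by (simp add: abs_clip_le)
  qed
qed

lemma riemann_sum_grid_diff:
  assumes "k < n"
  shows "riemann_sum n \<sigma> W (grid n (Suc k)) \<omega> - riemann_sum n \<sigma> W (grid n k) \<omega>
    = \<sigma> (grid n k) \<omega> * grid_incr W n k \<omega>"
proof -
  \<comment> \<open>At a grid point the truncation by \<open>min\<close> leaves the terms before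
    index \<open>i\<close> whole and collapses the others to zero.\<close>
  have *: "riemann_sum n \<sigma> W (grid n i) \<omega> = (\<Sum>k<n. if k < i then \<sigma> (grid n k) \<omega> * grid_incr W n k \<omega> else 0)" for i
    unfolding riemann_sum_def Let_def
  proof (intro sum.cong refl)
    fix k
    have "min (grid n (Suc k)) (grid n i) = grid n (Suc k) \<and> min (grid n k) (grid n i) = grid n k" if "k < i"
      using grid_mono[of "Suc k" i n] grid_mono[of k i n] that by auto
    moreover have "min (grid n (Suc k)) (grid n i) = grid n i \<and> min (grid n k) (grid n i) = grid n i" if "\<not> k < i"
      using grid_mono[of i "Suc k" n] grid_mono[of i k n] that by auto
    ultimately show "\<sigma> (- pi + 2 * pi * real k / real n) \<omega> *
         (W (min (- pi + 2 * pi * real (Suc k) / real n) (grid n i)) \<omega> - W (min (- pi + 2 * pi * real k / real n) (grid n i)) \<omega>)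
       = (if k < i then \<sigma> (grid n k) \<omega> * grid_incr W n k \<omega> else 0)"
      unfolding grid_def [symmetric] grid_incr_def by (cases "k < i") auto
  qed
  have "riemann_sum n \<sigma> W (grid n (Suc k)) \<omega> - riemann_sum n \<sigma> W (grid n k) \<omega>
    = (\<Sum>i<n. if i = k then \<sigma> (grid n i) \<omega> * grid_incr W n i \<omega> else 0)"
    unfolding * sum_subtractf [symmetric] by (intro sum.cong refl) auto
  also have "\<dots> = \<sigma> (grid n k) \<omega> * grid_incr W n k \<omega>"
    using assms by simp
  finally show ?thesis .
qed

lemma continuous_on_riemann_sum:
  assumes W: "continuous_on {-pi..pi} (\<lambda>t. W t \<omega>)" and n: "0 < n"
  shows "continuous_on {-pi..pi} (\<lambda>t. riemann_sum n \<sigma> W t \<omega>)"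
proof -
  have "continuous_on {-pi..pi} (\<lambda>t. W (min (grid n k) t) \<omega>)" if "k \<le> n" for k
    using grid_mem[OF that n]
    by (intro continuous_on_compose2[OF W] continuous_intros) (auto simp: min_def)
  then show ?thesis
    unfolding riemann_sum_def Let_def grid_def [symmetric] by (intro continuous_intros) auto
qed

lemma ito_process_AE_subsequence:
  assumes "prob_space M" and H: "ito_process M \<sigma> W x H"
  obtains \<nu> :: "nat \<Rightarrow> nat" where "filterlim \<nu> at_top sequentially" "\<And>j. 0 < \<nu> j"
    and "AE \<omega> in M. \<forall>\<^sub>F j in sequentially.
      (SUP t\<in>{-pi..pi}. \<bar>riemann_sum (\<nu> j) \<sigma> W t \<omega> - (H t \<omega> - x)\<bar>) \<le> (1 / 2) ^ j"
proof -
  interpret prob_space M by fact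
  define U where "U = (\<lambda>n \<omega>. SUP t\<in>{-pi..pi}. \<bar>riemann_sum n \<sigma> W t \<omega> - (H t \<omega> - x)\<bar>)"
  have U [measurable]: "U n \<in> borel_measurable M" for n
    using H by (simp add: ito_process_def U_def)
  have conv: "(\<lambda>n. prob {\<omega> \<in> space M. U n \<omega> > e}) \<longlonglongrightarrow> 0" if "e > 0" for e
    using H that unfolding ito_process_def U_def by blast
  \<comment> \<open>Both the tolerance and the probability are set to 2^{-j}: the probabilities are
    summable for Borel-Cantelli and the tolerance tends to 0. Asking n > j gives divergence and
    positivity of the subsequence.\<close>
  have "\<exists>n. n > j \<and> prob {\<omega> \<in> space M. U n \<omega> > (1 / 2) ^ j} < (1 / 2) ^ j" for j :: nat
  proof -
    have "\<forall>\<^sub>F n in sequentially. prob {\<omega> \<in> space M. U n \<omega> > (1 / 2) ^ j} < (1 / 2) ^ j"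
      by (rule order_tendstoD[OF conv]) auto
    with eventually_gt_at_top[of j] have "\<forall>\<^sub>F n in sequentially. n > j \<and> prob {\<omega> \<in> space M. U n \<omega> > (1 / 2) ^ j} < (1 / 2) ^ j"
      by eventually_elim auto
    then show ?thesis by (auto simp: eventually_sequentially)
  qed
  then obtain \<nu> where \<nu>: "\<And>j. \<nu> j > j" "\<And>j. prob {\<omega> \<in> space M. U (\<nu> j) \<omega> > (1 / 2) ^ j} < (1 / 2) ^ j"
    by metis
  have "AE \<omega> in M. \<forall>\<^sub>F j in sequentially. \<omega> \<in> space M - {\<omega> \<in> space M. U (\<nu> j) \<omega> > (1 / 2) ^ j}"
  proof (rule borel_cantelli_AE1)
    show "summable (\<lambda>j. prob {\<omega> \<in> space M. U (\<nu> j) \<omega> > (1 / 2) ^ j})"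
      by (rule summable_comparison_test'[of "\<lambda>j. (1 / 2 :: real) ^ j" 0])
        (auto intro: less_imp_le[OF \<nu>(2)] summable_geometric)
  qed (auto simp: emeasure_eq_measure less_top)
  then have "AE \<omega> in M. \<forall>\<^sub>F j in sequentially. U (\<nu> j) \<omega> \<le> (1 / 2) ^ j"
    by eventually_elim (auto elim!: eventually_mono)
  moreover have "filterlim \<nu> at_top sequentially"
    by (rule filterlim_at_top_mono[OF filterlim_ident]) (use \<nu>(1) in \<open>auto intro: less_imp_le always_eventually\<close>)
  moreover have "0 < \<nu> j" for j using \<nu>(1)[of j] by simp
  ultimately show ?thesis
    using that unfolding U_def by blast
qed

section \<open>Pathwise limits along the grid\<close>

lemma fourier_dH_grid_tendsto:
  fixes \<nu> :: "nat \<Rightarrow> nat"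
  assumes W: "continuous_on {-pi..pi} (\<lambda>t. W t \<omega>)" and H: "continuous_on {-pi..pi} (\<lambda>t. H t \<omega>)"
    and \<nu>: "filterlim \<nu> at_top sequentially" "\<And>j. 0 < \<nu> j"
    and sup: "\<forall>\<^sub>F j in sequentially.
      (SUP t\<in>{-pi..pi}. \<bar>riemann_sum (\<nu> j) \<sigma> W t \<omega> - (H t \<omega> - x)\<bar>) \<le> (1 / 2) ^ j"
  shows "(\<lambda>j. complex_of_real (1 / (2 * pi)) * (\<Sum>k<\<nu> j. cis (- real_of_int q * grid (\<nu> j) k) *
      complex_of_real (\<sigma> (grid (\<nu> j) k) \<omega> * grid_incr W (\<nu> j) k \<omega>)))
    \<longlonglongrightarrow> fourier_dH H q \<omega>"
proof -
  define U where "U = (\<lambda>j. SUP t\<in>{-pi..pi}. \<bar>riemann_sum (\<nu> j) \<sigma> W t \<omega> - (H t \<omega> - x)\<bar>)"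
  \<comment> \<open>A real supremum dominates the values only over a set bounded above; continuity
    on the compact interval provides this.\<close>
  have le: "\<bar>riemann_sum (\<nu> j) \<sigma> W t \<omega> - (H t \<omega> - x)\<bar> \<le> U j" if "t \<in> {-pi..pi}" for j t
  proof -
    have "compact ((\<lambda>t. \<bar>riemann_sum (\<nu> j) \<sigma> W t \<omega> - (H t \<omega> - x)\<bar>) ` {-pi..pi})"
      by (intro compact_continuous_image continuous_intros continuous_on_riemann_sum W H \<nu>(2)) simp
    then show ?thesis
      unfolding U_def by (intro cSUP_upper[OF that] bounded_imp_bdd_above compact_imp_bounded)
  qed
  have sums: "(\<Sum>k<\<nu> j. cis (- real_of_int q * grid (\<nu> j) k) *
      complex_of_real (\<sigma> (grid (\<nu> j) k) \<omega> * grid_incr W (\<nu> j) k \<omega>))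
    = (\<Sum>k<\<nu> j. cis (- real_of_int q * grid (\<nu> j) k) * complex_of_real
        (riemann_sum (\<nu> j) \<sigma> W (grid (\<nu> j) (Suc k)) \<omega> - riemann_sum (\<nu> j) \<sigma> W (grid (\<nu> j) k) \<omega>))" for j
    by (intro sum.cong refl) (simp only: riemann_sum_grid_diff lessThan_iff)
  have "U \<longlonglongrightarrow> 0"
  proof (rule tendsto_sandwich[OF _ _ tendsto_const])
    show "\<forall>\<^sub>F j in sequentially. 0 \<le> U j"
      using order_trans[OF abs_ge_zero le[of pi]] by simp
    show "\<forall>\<^sub>F j in sequentially. U j \<le> (1 / 2) ^ j"
      using sup by (simp add: U_def)
    show "(\<lambda>j. (1 / 2 :: real) ^ j) \<longlonglongrightarrow> 0"
      by (rule LIMSEQ_power_zero) simp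
  qed
  then have "(\<lambda>j. \<Sum>k<\<nu> j. cis (- real_of_int q * grid (\<nu> j) k) * complex_of_real
        (riemann_sum (\<nu> j) \<sigma> W (grid (\<nu> j) (Suc k)) \<omega> - riemann_sum (\<nu> j) \<sigma> W (grid (\<nu> j) k) \<omega>))
    \<longlonglongrightarrow> cis (- real_of_int q * pi) * complex_of_real (H pi \<omega> - x) - cis (real_of_int q * pi) * complex_of_real (H (-pi) \<omega> - x)
      + \<i> * complex_of_real (real_of_int q) *
        integral {-pi..pi} (\<lambda>t. cis (- real_of_int q * t) * complex_of_real (H t \<omega> - x))"
    by (intro grid_stieltjes_sum_tendsto[where h = "\<lambda>t. H t \<omega> - x" and \<delta> = U
          and g = "\<lambda>j k. riemann_sum (\<nu> j) \<sigma> W (grid (\<nu> j) k) \<omega>", OF _ \<nu>(1)])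
      (auto intro!: le grid_mem \<nu>(2) continuous_intros H simp del: atLeastAtMost_iff)
  then show ?thesis
    unfolding fourier_dH_shift[where H = H and \<omega> = \<omega> and q = q and x = x, OF H]
    by (intro tendsto_mult tendsto_const) (simp only: sums)
qed

text \<open>By \<open>off_diagonal_eq\<close> there are two limits: the grid Fourier coefficients
  converge to \<open>fourier_dH\<close>, and the weighted squares, being
  \<open>diagonal_error\<close> plus a Riemann sum, converge to the integral in
  \<open>fourier_v\<close>.\<close>

lemma off_diagonal_tendsto:
  fixes \<nu> :: "nat \<Rightarrow> nat"
  assumes W: "continuous_on {-pi..pi} (\<lambda>t. W t \<omega>)" and H: "continuous_on {-pi..pi} (\<lambda>t. H t \<omega>)"
    and \<sigma>: "continuous_on {-pi..pi} (\<lambda>t. \<sigma> t \<omega>)"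
    and \<nu>: "filterlim \<nu> at_top sequentially" "\<And>j. 0 < \<nu> j"
    and sup: "\<forall>\<^sub>F j in sequentially.
      (SUP t\<in>{-pi..pi}. \<bar>riemann_sum (\<nu> j) \<sigma> W t \<omega> - (H t \<omega> - x)\<bar>) \<le> (1 / 2) ^ j"
    and diag: "(\<lambda>n. diagonal_error q n (\<lambda>k. \<sigma> (grid n k) \<omega>) (\<lambda>k. grid_incr W n k \<omega>)) \<longlonglongrightarrow> 0"
  shows "(\<lambda>j. off_diagonal N q (\<nu> j) (\<lambda>k. \<sigma> (grid (\<nu> j) k) \<omega> * grid_incr W (\<nu> j) k \<omega>))
    \<longlonglongrightarrow> fourier_B N H q \<omega> - fourier_v \<sigma> q \<omega>"
proof -
  define f where "f = (\<lambda>t. cis (- real_of_int q * t) * complex_of_real ((\<sigma> t \<omega>)\<^sup>2))"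
  have "(\<lambda>n. diagonal_error q n (\<lambda>k. \<sigma> (grid n k) \<omega>) (\<lambda>k. grid_incr W n k \<omega>)
      + (\<Sum>k<n. complex_of_real (2 * pi / n) * f (grid n k))) \<longlonglongrightarrow> 0 + integral {-pi..pi} f"
    unfolding f_def by (intro tendsto_add diag grid_sum_tendsto_integral continuous_intros \<sigma>)
  moreover have "diagonal_error q n (\<lambda>k. \<sigma> (grid n k) \<omega>) (\<lambda>k. grid_incr W n k \<omega>)
      + (\<Sum>k<n. complex_of_real (2 * pi / n) * f (grid n k))
    = (\<Sum>k<n. cis (- real_of_int q * grid n k) * complex_of_real ((\<sigma> (grid n k) \<omega> * grid_incr W n k \<omega>)\<^sup>2))" for n
    unfolding diagonal_error_def f_def sum.distrib [symmetric]
    by (intro sum.cong refl) (simp add: algebra_simps power_mult_distrib)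
  ultimately have "(\<lambda>n. \<Sum>k<n. cis (- real_of_int q * grid n k) *
      complex_of_real ((\<sigma> (grid n k) \<omega> * grid_incr W n k \<omega>)\<^sup>2)) \<longlonglongrightarrow> integral {-pi..pi} f"
    by simp
  from filterlim_compose[OF this \<nu>(1)]
  have sq: "(\<lambda>j. \<Sum>k<\<nu> j. cis (- real_of_int q * grid (\<nu> j) k) *
      complex_of_real ((\<sigma> (grid (\<nu> j) k) \<omega> * grid_incr W (\<nu> j) k \<omega>)\<^sup>2)) \<longlonglongrightarrow> integral {-pi..pi} f" .
  show ?thesis
    unfolding off_diagonal_eq fourier_B_def fourier_v_def f_def [symmetric]
    by (intro tendsto_diff tendsto_mult tendsto_sum tendsto_const sq
        fourier_dH_grid_tendsto[where \<nu> = \<nu> and x = x] W H \<nu> sup)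
qed

text \<open>The Fejer weights lie in [0, 1] and the exponentials are unimodular, so the bound is
  uniform in \<open>t\<close>.\<close>

lemma cmod_fejer_diff_le:
  assumes "0 < m" and b: "\<And>l. l \<in> {- int m..int m} \<Longrightarrow> cmod (fourier_B N H l \<omega> - fourier_v \<sigma> l \<omega>) \<le> b"
  shows "cmod (fejer_T m \<sigma> t \<omega> - fejer_TB N m H t \<omega>) \<le> (2 * real m + 1) * b"
proof -
  let ?L = "{- int m..int m}"
  have "fejer_T m \<sigma> t \<omega> - fejer_TB N m H t \<omega>
    = (\<Sum>l\<in>?L. complex_of_real (1 - \<bar>real_of_int l\<bar> / real m) * (fourier_v \<sigma> l \<omega> - fourier_B N H l \<omega>) * cis (real_of_int l * t))"
    unfolding fejer_T_def fejer_TB_def sum_subtractf [symmetric] by (intro sum.cong refl) (simp add: algebra_simps)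
  also have "cmod \<dots> \<le> (\<Sum>l\<in>?L. b)"
  proof (rule sum_norm_le)
    fix l assume l: "l \<in> ?L"
    then have "\<bar>real_of_int l\<bar> \<le> real m" by auto
    then have w: "\<bar>1 - \<bar>real_of_int l\<bar> / real m\<bar> \<le> 1"
      using assms(1) by (simp add: abs_if field_simps)
    have "cmod (complex_of_real (1 - \<bar>real_of_int l\<bar> / real m) * (fourier_v \<sigma> l \<omega> - fourier_B N H l \<omega>) * cis (real_of_int l * t))
      = \<bar>1 - \<bar>real_of_int l\<bar> / real m\<bar> * cmod (fourier_B N H l \<omega> - fourier_v \<sigma> l \<omega>)"
      by (simp only: norm_mult norm_of_real norm_cis norm_minus_commute mult_1_right)
    also have "\<dots> \<le> 1 * b"
      using w b[OF l] by (intro mult_mono) auto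
    finally show "cmod (complex_of_real (1 - \<bar>real_of_int l\<bar> / real m) * (fourier_v \<sigma> l \<omega> - fourier_B N H l \<omega>) * cis (real_of_int l * t)) \<le> b"
      by simp
  qed
  also have "\<dots> = (2 * real m + 1) * b"
    by (simp add: nat_add_distrib)
  finally show ?thesis .
qed

section \<open>Almost sure convergence of the Fourier estimator\<close>

theorem mainTheorem6:
  fixes M :: "'a measure" and F :: "real \<Rightarrow> 'a measure"
    and W \<sigma> H :: "real \<Rightarrow> 'a \<Rightarrow> real" and x :: real
    and p \<alpha> \<beta> \<theta> r K :: real and Mseq :: "nat \<Rightarrow> nat"
  assumes space: "usual_filtered_space M F"
    and BM: "brownian_motion M F W"
    and sigma_prog: "progressive F \<sigma>"
    and sigma_cont: "\<forall>\<omega>\<in>space M. continuous_on {-pi..pi} (\<lambda>t. \<sigma> t \<omega>)"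
    and H: "ito_process M \<sigma> W x H"
    and p: "p > 2"
    and \<alpha>: "\<alpha> > 1" and \<beta>: "\<beta> > 1" and conj: "1 / \<alpha> + 1 / \<beta> = 1"
    and I: "cond_I M (p * max \<alpha> \<beta>) \<sigma>"
    and \<theta>: "0 < \<theta>" "\<theta> < 1 / (2 * \<beta>)"
    and r: "0 < r" "r < min (1 / (2 * \<beta>) - \<theta>) (\<theta> * p - 1)"
    and K: "K > 0"
    and Mseq: "\<forall>N\<ge>1. Mseq N \<ge> 1 \<and> real (Mseq N) \<le> K * real N powr r"
  shows "AE \<omega> in M. (\<lambda>N. SUP t\<in>{-pi..pi}.
            cmod (fejer_T (Mseq N) \<sigma> t \<omega> - fejer_TB N (Mseq N) H t \<omega>)) \<longlonglongrightarrow> 0"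
proof -
  interpret prob_space M using space by (simp add: usual_filtered_space_def)
  have W_cont: "continuous_on {-pi..pi} (\<lambda>t. W t \<omega>)" if "\<omega> \<in> space M" for \<omega>
    using BM that by (simp add: brownian_motion_def)
  have H_cont: "continuous_on {-pi..pi} (\<lambda>t. H t \<omega>)" if "\<omega> \<in> space M" for \<omega>
    using H that by (simp add: ito_process_def)
  have r_half: "r < 1 / 2"
  proof -
    have "1 / (2 * \<beta>) < 1 / 2" using \<beta> by (simp add: field_simps)
    then show ?thesis using r(2) \<theta>(1) by linarith
  qed
  \<comment> \<open>A single subsequence, fixed before \<open>m\<close>, \<open>N\<close> and
    \<open>q\<close>, serves all of them.\<close>
  obtain \<nu> where \<nu>: "filterlim \<nu> at_top sequentially" "\<And>j. 0 < \<nu> j"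
    and sup: "AE \<omega> in M. \<forall>\<^sub>F j in sequentially.
      (SUP t\<in>{-pi..pi}. \<bar>riemann_sum (\<nu> j) \<sigma> W t \<omega> - (H t \<omega> - x)\<bar>) \<le> (1 / 2) ^ j"
    using ito_process_AE_subsequence[OF prob_space_axioms H] by blast
  have local: "AE \<omega> in M. (\<forall>t\<in>{-pi..pi}. \<bar>\<sigma> t \<omega>\<bar> \<le> m) \<longrightarrow> (\<lambda>N. SUP t\<in>{-pi..pi}.
      cmod (fejer_T (Mseq N) \<sigma> t \<omega> - fejer_TB N (Mseq N) H t \<omega>)) \<longlonglongrightarrow> 0"
    if m: "0 < m" for m :: real
  proof -
    define a where "a = (\<lambda>n k \<omega>. clip m (\<sigma> (grid n k) \<omega>))"
    define l where "l = (\<lambda>N :: nat. sqrt (2 * real N + 1) / (8 * m\<^sup>2))"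
    \<comment> \<open>The liminf is the form in which Fatou passes the bound 12 to the limit, and it
      is measurable by construction. On good paths it is identified below with the exponential of
      the true coefficient error.\<close>
    define g where "g = (\<lambda>N q \<omega>. liminf (\<lambda>j. ennreal (exp (l N *
      cmod (off_diagonal N q (\<nu> j) (\<lambda>k. a (\<nu> j) k \<omega> * grid_incr W (\<nu> j) k \<omega>)) / 2))))"
    have gg: "gaussian_grid M (\<lambda>k. F (grid n k)) (grid_incr W n) n (a n) m" if "0 < n" for n
      unfolding a_def by (rule gaussian_grid_brownian[OF space BM sigma_prog that m])
    have diag: "AE \<omega> in M. \<forall>q. (\<lambda>n. diagonal_error q n (\<lambda>k. a n k \<omega>) (\<lambda>k. grid_incr W n k \<omega>)) \<longlonglongrightarrow> 0"
    proof (subst AE_all_countable, intro allI)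
      fix q
      have "AE \<omega> in M. (\<lambda>n. cmod (diagonal_error q n (\<lambda>k. a n k \<omega>) (\<lambda>k. grid_incr W n k \<omega>))) \<longlonglongrightarrow> 0"
      \<comment> \<open>\<open>\<kappa>\<close> absorbs the halving of the modulus in the
        exponential moment bound.\<close>
      proof (rule AE_tendsto_0_of_exp_moments[where \<kappa> = "1 / (16 * pi * m\<^sup>2)" and C = "4 * exp (1 / 4)"])
        fix n :: nat assume n: "0 < n"
        show "(\<lambda>\<omega>. cmod (diagonal_error q n (\<lambda>k. a n k \<omega>) (\<lambda>k. grid_incr W n k \<omega>))) \<in> borel_measurable M"
          using gaussian_grid.diagonal_error_measurable[OF gg[OF n]] by simp
        show "(\<integral>\<^sup>+\<omega>. ennreal (exp (sqrt n * (1 / (16 * pi * m\<^sup>2)) *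
            cmod (diagonal_error q n (\<lambda>k. a n k \<omega>) (\<lambda>k. grid_incr W n k \<omega>)))) \<partial>M) \<le> ennreal (4 * exp (1 / 4))"
          using gaussian_grid.nn_integral_exp_diagonal_error_le[OF gg[OF n], of q] by (simp add: mult_ac)
      qed (use m in auto)
      then show "AE \<omega> in M. (\<lambda>n. diagonal_error q n (\<lambda>k. a n k \<omega>) (\<lambda>k. grid_incr W n k \<omega>)) \<longlonglongrightarrow> 0"
        by (simp add: tendsto_norm_zero_iff)
    qed
    have off_M: "(\<lambda>\<omega>. ennreal (exp (l N * cmod (off_diagonal N q (\<nu> j) (\<lambda>k. a (\<nu> j) k \<omega> * grid_incr W (\<nu> j) k \<omega>)) / 2)))
        \<in> borel_measurable M" for N q j
      using gaussian_grid.off_diagonal_measurable[OF gg[OF \<nu>(2)], of N q j] by simp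
    have g_M [measurable]: "g N q \<in> borel_measurable M" for N q
      unfolding g_def by (intro borel_measurable_liminf off_M)
    have g_le: "(\<integral>\<^sup>+\<omega>. g N q \<omega> \<partial>M) \<le> ennreal 12" for N q
    proof -
      have "(\<integral>\<^sup>+\<omega>. g N q \<omega> \<partial>M) \<le> liminf (\<lambda>j. \<integral>\<^sup>+\<omega>. ennreal (exp (l N *
          cmod (off_diagonal N q (\<nu> j) (\<lambda>k. a (\<nu> j) k \<omega> * grid_incr W (\<nu> j) k \<omega>)) / 2)) \<partial>M)"
        unfolding g_def by (intro nn_integral_liminf off_M)
      also have "\<dots> \<le> liminf (\<lambda>j :: nat. ennreal 12)"
      proof (rule Liminf_mono)
        have "\<forall>\<^sub>F j in sequentially. \<nu> j > 2 * N"
          using \<nu>(1) unfolding filterlim_at_top by (simp add: Suc_le_eq [symmetric])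
        then show "\<forall>\<^sub>F j in sequentially. (\<integral>\<^sup>+\<omega>. ennreal (exp (l N *
          cmod (off_diagonal N q (\<nu> j) (\<lambda>k. a (\<nu> j) k \<omega> * grid_incr W (\<nu> j) k \<omega>)) / 2)) \<partial>M) \<le> ennreal 12"
          unfolding l_def
          by eventually_elim (rule gaussian_grid.nn_integral_exp_off_diagonal_le[OF gg[OF \<nu>(2)]])
      qed
      also have "\<dots> = ennreal 12" by (simp add: Liminf_const)
      finally show ?thesis .
    qed
    \<comment> \<open>There are at most \<open>(2 * K + 1) * N\<close> frequencies, by the crude N^r
      \<le> N, so the weight N^{-3} leaves the summable N^{-2}.\<close>
    define f where "f = (\<lambda>N \<omega>. if N = 0 then 0 else
      ennreal (1 / real N ^ 3) * (\<Sum>q\<in>{- int (Mseq N)..int (Mseq N)}. g N q \<omega>))"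
    have f: "AE \<omega> in M. \<forall>\<^sub>F N in sequentially. f N \<omega> < 1"
    proof (rule AE_eventually_less_1)
      fix N
      show "f N \<in> borel_measurable M"
        unfolding f_def by (cases "N = 0") simp_all
      show "(\<integral>\<^sup>+\<omega>. f N \<omega> \<partial>M) \<le> ennreal (1 / real N ^ 2 * (12 * (2 * K + 1)))"
      proof (cases "N = 0")
        case False
        then have "(\<integral>\<^sup>+\<omega>. f N \<omega> \<partial>M) = ennreal (1 / real N ^ 3) *
            (\<Sum>q\<in>{- int (Mseq N)..int (Mseq N)}. \<integral>\<^sup>+\<omega>. g N q \<omega> \<partial>M)"
          by (simp add: f_def nn_integral_cmult nn_integral_sum)
        also have "\<dots> \<le> ennreal (1 / real N ^ 3) * (\<Sum>q\<in>{- int (Mseq N)..int (Mseq N)}. ennreal 12)"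
          by (intro mult_left_mono sum_mono g_le) auto
        also have "(\<Sum>q\<in>{- int (Mseq N)..int (Mseq N)}. ennreal 12) = ennreal (12 * (2 * real (Mseq N) + 1))"
          by (subst sum_ennreal) (auto simp: nat_add_distrib algebra_simps)
        also have "ennreal (1 / real N ^ 3) * \<dots> = ennreal (1 / real N ^ 3 * (12 * (2 * real (Mseq N) + 1)))"
          by (rule ennreal_mult [symmetric]) auto
        also have "\<dots> \<le> ennreal (1 / real N ^ 2 * (12 * (2 * K + 1)))"
        proof (rule ennreal_leI)
          have N: "1 \<le> real N" using False by simp
          then have "real N powr r \<le> real N powr 1" using r_half by (intro powr_mono) auto
          then have "K * real N powr r \<le> K * real N" using K N by simp
          then have "real (Mseq N) \<le> K * real N" using Mseq False by (meson leI less_one order_trans)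
          then have "12 * (2 * real (Mseq N) + 1) \<le> real N * (12 * (2 * K + 1))"
            using N by (simp add: algebra_simps)
          then have "1 / real N ^ 3 * (12 * (2 * real (Mseq N) + 1)) \<le> 1 / real N ^ 3 * (real N * (12 * (2 * K + 1)))"
            by (rule mult_left_mono) simp
          also have "\<dots> = 1 / real N ^ 2 * (12 * (2 * K + 1))"
            using False by (simp add: power2_eq_square power3_eq_cube)
          finally show "1 / real N ^ 3 * (12 * (2 * real (Mseq N) + 1)) \<le> 1 / real N ^ 2 * (12 * (2 * K + 1))" .
        qed
        finally show ?thesis .
      qed (simp add: f_def)
      show "0 \<le> 1 / real N ^ 2 * (12 * (2 * K + 1))" using K by simp
    next
      have "summable (\<lambda>n. inverse (real n ^ 2))" by (rule inverse_power_summable) simp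
      then show "summable (\<lambda>n. 1 / real n ^ 2 * (12 * (2 * K + 1)))"
        by (intro summable_mult2) (simp add: inverse_eq_divide)
    qed
    \<comment> \<open>\<open>f N \<omega> < 1\<close> forces exp (l_N s / 2) < N^3 for each
      coefficient error s, hence s < 6 ln N / l_N, which is \<open>b N\<close>.\<close>
    define b where "b = (\<lambda>N :: nat. 6 * ln N * (8 * m\<^sup>2) / sqrt (2 * real N + 1))"
    from AE_space sup diag f show ?thesis
    proof (eventually_elim, intro impI)
      case (elim \<omega>)
      assume bound: "\<forall>t\<in>{-pi..pi}. \<bar>\<sigma> t \<omega>\<bar> \<le> m"
      \<comment> \<open>On this path clipping changes nothing, so the estimates for the clipped sums
        apply to the actual ones.\<close>
      have a_eq: "a n k \<omega> = \<sigma> (grid n k) \<omega>" if "k < n" for n k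
        unfolding a_def using bound grid_mem[of k n] that by (intro clip_id) auto
      have dg: "(\<lambda>n. diagonal_error q n (\<lambda>k. \<sigma> (grid n k) \<omega>) (\<lambda>k. grid_incr W n k \<omega>)) \<longlonglongrightarrow> 0" for q
        using elim(3)[rule_format, of q] by (simp add: diagonal_error_def a_eq cong: sum.cong_simp)
      have "(\<lambda>j. off_diagonal N q (\<nu> j) (\<lambda>k. \<sigma> (grid (\<nu> j) k) \<omega> * grid_incr W (\<nu> j) k \<omega>))
          \<longlonglongrightarrow> fourier_B N H q \<omega> - fourier_v \<sigma> q \<omega>" for N q
        using sigma_cont elim(1)
        by (intro off_diagonal_tendsto[where \<nu> = \<nu> and x = x] W_cont H_cont \<nu> elim(2) dg) auto
      then have lim: "(\<lambda>j. off_diagonal N q (\<nu> j) (\<lambda>k. a (\<nu> j) k \<omega> * grid_incr W (\<nu> j) k \<omega>))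
          \<longlonglongrightarrow> fourier_B N H q \<omega> - fourier_v \<sigma> q \<omega>" for N q
        by (simp add: off_diagonal_def a_eq cong: sum.cong_simp)
      have g_eq: "g N q \<omega> = ennreal (exp (l N * cmod (fourier_B N H q \<omega> - fourier_v \<sigma> q \<omega>) / 2))" for N q
        unfolding g_def by (intro lim_imp_Liminf tendsto_intros lim) auto
      have ev: "\<forall>\<^sub>F N in sequentially. (SUP t\<in>{-pi..pi}. cmod (fejer_T (Mseq N) \<sigma> t \<omega> - fejer_TB N (Mseq N) H t \<omega>))
          \<in> {0..(2 * (K * real N powr r) + 1) * b N}"
        using elim(4) eventually_gt_at_top[of 0]
      proof eventually_elim
        case (elim N)
        have M: "0 < Mseq N" "real (Mseq N) \<le> K * real N powr r"
          using Mseq elim(2) by (auto simp: Suc_le_eq)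
        have l_pos: "0 < l N" using m by (simp add: l_def)
        have b_nonneg: "0 \<le> b N" using elim(2) by (simp add: b_def)
        have "cmod (fourier_B N H q \<omega> - fourier_v \<sigma> q \<omega>) \<le> b N" if q: "q \<in> {- int (Mseq N)..int (Mseq N)}" for q
        proof -
          let ?s = "cmod (fourier_B N H q \<omega> - fourier_v \<sigma> q \<omega>)"
          have "ennreal (1 / real N ^ 3 * exp (l N * ?s / 2)) = ennreal (1 / real N ^ 3) * g N q \<omega>"
            unfolding g_eq by (rule ennreal_mult) auto
          also have "\<dots> \<le> f N \<omega>"
            unfolding f_def using elim(2) q by (auto intro!: mult_left_mono member_le_sum)
          also have "\<dots> < ennreal 1" using elim(1) by simp
          finally have "1 / real N ^ 3 * exp (l N * ?s / 2) < 1"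
            by (subst (asm) ennreal_less_iff) auto
          then have "exp (l N * ?s / 2) < real N ^ 3"
            using elim(2) by (simp add: divide_less_eq)
          then have "l N * ?s / 2 < ln (real N ^ 3)"
            using elim(2) by (metis exp_gt_zero ln_exp ln_less_cancel_iff order_less_trans)
          then have "?s \<le> 6 * ln N / l N"
            using elim(2) l_pos by (simp add: ln_realpow pos_le_divide_eq mult_ac)
          also have "\<dots> = b N" by (simp add: b_def l_def)
          finally show ?thesis .
        qed
        then have le: "cmod (fejer_T (Mseq N) \<sigma> t \<omega> - fejer_TB N (Mseq N) H t \<omega>) \<le> (2 * real (Mseq N) + 1) * b N" for t
          by (rule cmod_fejer_diff_le[OF M(1)])
        have "(2 * real (Mseq N) + 1) * b N \<le> (2 * (K * real N powr r) + 1) * b N"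
          using M(2) b_nonneg by (intro mult_right_mono) auto
        moreover have "(SUP t\<in>{-pi..pi}. cmod (fejer_T (Mseq N) \<sigma> t \<omega> - fejer_TB N (Mseq N) H t \<omega>))
            \<le> (2 * real (Mseq N) + 1) * b N"
          by (rule cSUP_least) (auto intro: le)
        moreover have "0 \<le> (SUP t\<in>{-pi..pi}. cmod (fejer_T (Mseq N) \<sigma> t \<omega> - fejer_TB N (Mseq N) H t \<omega>))"
          by (rule order_trans[OF norm_ge_zero cSUP_upper[where x = pi]]) (auto intro!: bdd_aboveI2 le)
        ultimately show ?case by simp
      qed
      \<comment> \<open>The product has order N^{r - 1/2} ln N, which vanishes because r <
        1/2.\<close>
      have lim_0: "(\<lambda>N. (2 * (K * real N powr r) + 1) * b N) \<longlonglongrightarrow> 0"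
        unfolding b_def using r_half r(1) K m by real_asymp
      show "(\<lambda>N. SUP t\<in>{-pi..pi}. cmod (fejer_T (Mseq N) \<sigma> t \<omega> - fejer_TB N (Mseq N) H t \<omega>)) \<longlonglongrightarrow> 0"
        by (rule tendsto_sandwich[OF _ _ tendsto_const lim_0]; rule eventually_mono[OF ev]) simp_all
    qed
  qed
  \<comment> \<open>With integer levels only countably many null sets are discarded;
    \<open>Suc m\<close> is the positive level that clipping asks for.\<close>
  have "AE \<omega> in M. \<forall>m :: nat. (\<forall>t\<in>{-pi..pi}. \<bar>\<sigma> t \<omega>\<bar> \<le> Suc m) \<longrightarrow> (\<lambda>N. SUP t\<in>{-pi..pi}.
      cmod (fejer_T (Mseq N) \<sigma> t \<omega> - fejer_TB N (Mseq N) H t \<omega>)) \<longlonglongrightarrow> 0"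
    unfolding AE_all_countable by (intro allI local) simp
  with AE_space show ?thesis
  proof eventually_elim
    case (elim \<omega>)
    have "bounded ((\<lambda>t. \<sigma> t \<omega>) ` {-pi..pi})"
      using sigma_cont elim(1) by (intro compact_imp_bounded compact_continuous_image) auto
    then obtain B where B: "\<forall>t\<in>{-pi..pi}. \<bar>\<sigma> t \<omega>\<bar> \<le> B"
      by (auto simp: bounded_iff simp del: atLeastAtMost_iff)
    obtain m :: nat where "B \<le> m" using real_arch_simple by blast
    then have "\<forall>t\<in>{-pi..pi}. \<bar>\<sigma> t \<omega>\<bar> \<le> Suc m" using B by force
    then show ?case using elim(2) by blast
  qed
qed

end
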